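(* Let $\mathcal{H}$ be a separable infinite-dimensional Hilbert space and let $A,B\in\mathcal{L}(\mathcal{H})$ be compact operators. Consider the equation $XAY=B$ in the unknown pair $(X,Y)\in\mathcal{L}(\mathcal{H})\times\mathcal{L}(\mathcal{H})$, and let $U(A,B)$ be the set of all $X\in\mathcal{L}(\mathcal{H})$ for which there is $Y\in\mathcal{L}(\mathcal{H})$ with $XAY=B$. (i) The equation $XAY=B$ is solvable if and only if $s_n(B)=O(s_n(A))$. (ii) Suppose that $s_n(B)=O(s_n(A))$. If the operators $A,B$ have dense ranges, or if the range of $A$ is non-lacunary, then $U(A,B)$ is dense in $\mathcal{L}(\mathcal{H})$ in the weak operator topology. (iii) If the range of the operator $B$ is not dense and the condition $s_n(B)=O(s_{n+1}(A))$ does not hold, then $U(A,B)$ is not dense in $\mathcal{L}(\mathcal{H})$ in the weak operator topology.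
   Context: $\mathcal{L}(\mathcal{H})$ is the space of bounded linear operators on $\mathcal{H}$. $\{s_n(E)\}_{n=1}^\infty$ denotes the sequence of $s$-numbers (singular values) of a compact operator $E$: the eigenvalues of $(E^*E)^{1/2}$ in non-increasing order, counted with multiplicity (and continued by zeros if $E$ has finite rank). A non-increasing sequence of positive numbers $a_n\to 0$ is lacunary if $\liminf_{n\to\infty}a_{n+1}/a_n=0$. The range of a compact operator $A$ of infinite rank is called lacunary (non-lacunary) if the sequence $\{s_n(A)\}_{n=1}^\infty$ is lacunary (not lacunary); "the range of $A$ is non-lacunary" presupposes that $A$ has infinite rank. For sequences of non-negative numbers, $b_n=O(a_n)$ means that there is $C<\infty$ with $b_n\le Ca_n$ for all $n$. *)

theory Defs
  imports "HOL-Analysis.Analysis"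
begin

section \<open>Complex Hilbert spaces\<close>

text \<open>
  A complex Hilbert space is presented as a complete real inner product space carrying in addition
  a compatible complex scalar multiplication and a complex inner product (linear in the first
  argument) whose real part is the given real inner product.  Norm, metric and
  topology are thus those of the libraries, and positive definiteness of the complex inner product
  is inherited from the real one.
\<close>

class complex_vector = real_vector +
  fixes scaleC :: "complex \<Rightarrow> 'a \<Rightarrow> 'a"  (infixr \<open>*\<^sub>C\<close> 75)
  assumes scaleC_add_right: "a *\<^sub>C (x + y) = a *\<^sub>C x + a *\<^sub>C y"
    and scaleC_add_left: "(a + b) *\<^sub>C x = a *\<^sub>C x + b *\<^sub>C x"
    and scaleC_scaleC: "a *\<^sub>C b *\<^sub>C x = (a * b) *\<^sub>C x"
    and scaleC_one: "1 *\<^sub>C x = x"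
    and scaleR_scaleC: "r *\<^sub>R x = complex_of_real r *\<^sub>C x"

class complex_inner = complex_vector + real_inner +
  fixes cinner :: "'a \<Rightarrow> 'a \<Rightarrow> complex"
  assumes cinner_commute: "cinner x y = cnj (cinner y x)"
    and cinner_add_left: "cinner (x + y) z = cinner x z + cinner y z"
    and cinner_scaleC_left: "cinner (c *\<^sub>C x) y = c * cinner x y"
    and inner_eq_Re_cinner: "inner x y = Re (cinner x y)"

class chilbert_space = complex_inner + complete_space

global_interpretation complex_vector:
  vector_space "scaleC :: complex \<Rightarrow> 'a \<Rightarrow> 'a :: complex_vector"
  by unfold_locales (rule scaleC_add_right scaleC_add_left scaleC_scaleC scaleC_one)+

definition cfinite_dim :: "'a::complex_vector set \<Rightarrow> bool" where
  "cfinite_dim S \<longleftrightarrow> (\<exists>F. finite F \<and> S \<subseteq> complex_vector.span F)"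


section \<open>Operators\<close>

definition bounded_clinear :: "('a::complex_inner \<Rightarrow> 'b::complex_inner) \<Rightarrow> bool" where
  "bounded_clinear T \<longleftrightarrow> bounded_linear T \<and> (\<forall>c x. T (c *\<^sub>C x) = c *\<^sub>C T x)"

definition compact_operator :: "('a::complex_inner \<Rightarrow> 'b::complex_inner) \<Rightarrow> bool" where
  "compact_operator T \<longleftrightarrow>
     bounded_clinear T \<and> (\<forall>S. bounded S \<longrightarrow> compact (closure (T ` S)))"

definition cadjoint :: "('a::complex_inner \<Rightarrow> 'b::complex_inner) \<Rightarrow> 'b \<Rightarrow> 'a" where
  "cadjoint T = (THE S. \<forall>x y. cinner (T x) y = cinner x (S y))"

definition positive_operator :: "('a::complex_inner \<Rightarrow> 'a) \<Rightarrow> bool" where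
  "positive_operator T \<longleftrightarrow> bounded_clinear T \<and> (\<forall>x. cinner (T x) x \<in> \<real>\<^sub>\<ge>\<^sub>0)"

definition sqrt_operator :: "('a::complex_inner \<Rightarrow> 'a) \<Rightarrow> 'a \<Rightarrow> 'a" where
  "sqrt_operator T = (THE P. positive_operator P \<and> P \<circ> P = T)"

definition eigenspace :: "('a::complex_vector \<Rightarrow> 'a) \<Rightarrow> complex \<Rightarrow> 'a set" where
  "eigenspace T c = {x. T x = c *\<^sub>C x}"


section \<open>Singular values and lacunary ranges\<close>

text \<open>
  The sequence \<open>s\<close> lists the positive eigenvalues of the positive operator \<open>P\<close> in non-increasing
  order, each as often as its multiplicity, and is continued by zeros if there are only finitely
  many of them.  If there are infinitely many, the eigenvalue \<open>0\<close> does not occur in the list.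
  Finiteness of the level sets is required because \<open>card\<close> and \<open>dim\<close> are both \<open>0\<close> in the infinite
  case; for compact \<open>P\<close> the eigenspaces in question are finite-dimensional.
\<close>

definition eigenvalue_sequence :: "('a::complex_inner \<Rightarrow> 'a) \<Rightarrow> (nat \<Rightarrow> real) \<Rightarrow> bool" where
  "eigenvalue_sequence P s \<longleftrightarrow>
     decseq s \<and> (\<forall>n. 0 \<le> s n) \<and>
     (\<forall>r>0. finite {n. s n = r} \<and>
            card {n. s n = r} = complex_vector.dim (eigenspace P (complex_of_real r)))"

text \<open>Indices start at \<open>0\<close>: the value \<open>s_number E n\<close> is the usual $s_{n+1}(E)$.\<close>

definition s_number :: "('a::complex_inner \<Rightarrow> 'a) \<Rightarrow> nat \<Rightarrow> real" where
  "s_number E = (THE s. eigenvalue_sequence (sqrt_operator (cadjoint E \<circ> E)) s)"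

text \<open>The next notion is meant for non-increasing sequences of positive numbers tending to \<open>0\<close>.\<close>

definition lacunary :: "(nat \<Rightarrow> real) \<Rightarrow> bool" where
  "lacunary a \<longleftrightarrow> liminf (\<lambda>n. ereal (a (Suc n) / a n)) = 0"

definition nonlacunary_range :: "('a::complex_inner \<Rightarrow> 'a) \<Rightarrow> bool" where
  "nonlacunary_range A \<longleftrightarrow> \<not> cfinite_dim (range A) \<and> \<not> lacunary (s_number A)"

definition dense_range :: "('a \<Rightarrow> 'b::topological_space) \<Rightarrow> bool" where
  "dense_range T \<longleftrightarrow> closure (range T) = UNIV"

text \<open>
  The bound is required for every index; \<open>bigo\<close> at \<open>sequentially\<close> would only require it
  eventually, which is weaker when \<open>a\<close> has zeros.
\<close>

definition big_O_seq :: "(nat \<Rightarrow> real) \<Rightarrow> (nat \<Rightarrow> real) \<Rightarrow> bool" where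
  "big_O_seq b a \<longleftrightarrow> (\<exists>C. \<forall>n. b n \<le> C * a n)"


section \<open>The weak operator topology and the equation \<open>XAY = B\<close>\<close>

text \<open>
  The weak operator topology on the space of bounded operators: the coarsest one making all
  functionals \<open>T \<mapsto> \<langle>T x, y\<rangle>\<close> continuous.
\<close>

definition weak_operator_topology :: "('a::complex_inner \<Rightarrow> 'a) topology" where
  "weak_operator_topology =
     topology_generated_by {{T. bounded_clinear T \<and> cinner (T x) y \<in> V} | x y V. open V}"

lemma topspace_weak_operator_topology:
  "topspace weak_operator_topology = {T. bounded_clinear T}"
  unfolding weak_operator_topology_def topology_generated_by_topspace
  using open_UNIV by blast

definition wot_dense :: "('a::complex_inner \<Rightarrow> 'a) set \<Rightarrow> bool" where
  "wot_dense U \<longleftrightarrow> weak_operator_topology closure_of U = {T. bounded_clinear T}"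

definition solvable_XAY :: "('a::complex_inner \<Rightarrow> 'a) \<Rightarrow> ('a \<Rightarrow> 'a) \<Rightarrow> bool" where
  "solvable_XAY A B \<longleftrightarrow>
     (\<exists>X Y. bounded_clinear X \<and> bounded_clinear Y \<and> X \<circ> A \<circ> Y = B)"

definition U_XAY :: "('a::complex_inner \<Rightarrow> 'a) \<Rightarrow> ('a \<Rightarrow> 'a) \<Rightarrow> ('a \<Rightarrow> 'a) set" where
  "U_XAY A B =
     {X. bounded_clinear X \<and> (\<exists>Y. bounded_clinear Y \<and> X \<circ> A \<circ> Y = B)}"

end

theory Submission
  imports Defs
begin

text \<open>
  Write \<open>A = \<Sum>n. a n \<langle>\<cdot>, e n\<rangle> f n\<close> and \<open>B = \<Sum>n. b n \<langle>\<cdot>, g n\<rangle> h n\<close>.  If \<open>b = O(a)\<close>, the diagonal operators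
  \<open>g n \<mapsto> (b n / a n) e n\<close> and \<open>f n \<mapsto> h n\<close> solve the equation; conversely, a vector \<open>x\<close> in the span
  of \<open>g 0, \<dots>, g n\<close> with \<open>Y x\<close> orthogonal to \<open>e i\<close> for \<open>i < n\<close> gives \<open>b n = O(a n)\<close>.  In the
  non-lacunary case finitely many dimensions can be given up without changing the order of the
  singular values, so \<open>X\<close> may be prescribed on any finite set.  For dense ranges a bounded sequence of
  solutions \<open>X\<close> is built whose compressions to the first \<open>N\<close> basis vectors are prescribed.
  Finally, if \<open>w\<close> is orthogonal to the range of \<open>B\<close> and \<open>\<langle>X f 0, w\<rangle> \<noteq> 0\<close>, then \<open>X A Y = B\<close> forces
  \<open>b n = O(a (n + 1))\<close>; otherwise a nonempty open set of operators \<open>X\<close> contains no solution.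
\<close>

section \<open>Complex inner products\<close>

\<comment> \<open>Only \<open>X\<close> is approximated; the norm of \<open>Y\<close> may grow
  without bound along the way. With dense ranges this freedom is essential: for \<open>N\<close>
  \<le> \<open>n\<close> < \<open>2 * N\<close> the second factor uses coefficients
  \<open>b (n - N) / a n\<close>, which no constant bounds for all \<open>N\<close>. Giving up
  \<open>N\<close> dimensions, as in the non-lacunary case, would ask for \<open>b n\<close> =
  O(\<open>a (n + N)\<close>), which can fail for lacunary \<open>a\<close>; hence a permutation
  that moves only finitely many indices. In the obstruction, \<open>f 0\<close> belongs to the
  largest singular value, so losing it shifts the whole sequence by one. All families are infinite,
  even for finite rank: a zero coefficient is paired with arbitrary orthonormal vectors. Finite and
  infinite rank are thus treated alike, and the convention that division by 0 gives 0 takes care of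
  the zero coefficients.\<close>
subclass (in chilbert_space) banach ..

lemma cinner_add_right: "cinner x (y + z) = cinner x y + cinner x z"
  by (metis cinner_add_left cinner_commute complex_cnj_add)

lemma cinner_scaleC_right: "cinner x (c *\<^sub>C y) = cnj c * cinner x y"
  by (metis cinner_scaleC_left cinner_commute complex_cnj_mult)

lemma cinner_self: "cinner x x = complex_of_real ((norm x)\<^sup>2)"
proof -
  have "Im (cinner x x) = 0"
    using arg_cong[OF cinner_commute[of x x], of Im] by simp
  then show ?thesis
    by (simp add: complex_eq_iff power2_norm_eq_inner inner_eq_Re_cinner)
qed

lemma norm_scaleC [simp]: "norm (c *\<^sub>C x) = cmod c * norm x" for x :: "'a::complex_inner"
proof -
  have "complex_of_real ((norm (c *\<^sub>C x))\<^sup>2) = c * cnj c * complex_of_real ((norm x)\<^sup>2)"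
    by (simp add: cinner_self[symmetric] cinner_scaleC_left cinner_scaleC_right del: of_real_power)
  also have "\<dots> = complex_of_real ((cmod c * norm x)\<^sup>2)"
    by (simp add: complex_norm_square[symmetric] power_mult_distrib flip: of_real_power of_real_mult)
  finally show ?thesis
    by (metis norm_ge_zero mult_nonneg_nonneg of_real_eq_iff power2_eq_imp_eq)
qed

text \<open>Multiplying \<open>x\<close> by a phase makes the product real and nonnegative, so the
  real Cauchy-Schwarz inequality applies.\<close>

lemma norm_cinner_le: "cmod (cinner x y) \<le> norm x * norm y"
proof (cases "cinner x y = 0")
  case False
  define c where "c = cnj (sgn (cinner x y))"
  have c: "cmod c = 1" using False by (simp add: c_def norm_sgn)
  have "c * cinner x y = complex_of_real (cmod (cinner x y))"
    using False by (simp add: c_def sgn_div_norm scaleR_conv_of_real mult.commute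
        complex_norm_square[symmetric] divide_simps power2_eq_square)
  then have "cmod (cinner x y) = inner (c *\<^sub>C x) y"
    by (simp add: inner_eq_Re_cinner cinner_scaleC_left)
  also have "\<dots> \<le> norm (c *\<^sub>C x) * norm y" by (rule norm_cauchy_schwarz)
  finally show ?thesis using c by simp
qed simp

lemma scaleC_scaleR: "c *\<^sub>C (r *\<^sub>R x) = r *\<^sub>R (c *\<^sub>C x)"
  by (simp add: scaleR_scaleC scaleC_scaleC mult.commute)

text \<open>Over the reals conjugate-linearity is ordinary linearity, so the theory of bounded
  bilinear maps supplies the rules for sums, differences, limits and series.\<close>

lemma bounded_bilinear_cinner: "bounded_bilinear (cinner :: 'a::complex_inner \<Rightarrow> 'a \<Rightarrow> complex)"
proof
  show "\<exists>K. \<forall>a b :: 'a. norm (cinner a b) \<le> norm a * norm b * K"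
    by (rule exI[of _ 1]) (simp add: norm_cinner_le)
qed (simp_all add: cinner_add_left cinner_add_right scaleR_scaleC cinner_scaleC_left
      cinner_scaleC_right scaleR_conv_of_real)

interpretation cinner: bounded_bilinear "cinner :: 'a::complex_inner \<Rightarrow> 'a \<Rightarrow> complex"
  by (rule bounded_bilinear_cinner)

declare cinner.zero_left [simp] cinner.zero_right [simp]

lemma bounded_bilinear_scaleC:
  "bounded_bilinear (scaleC :: complex \<Rightarrow> 'a::complex_inner \<Rightarrow> 'a)"
proof
  show "\<exists>K. \<forall>a (b :: 'a). norm (a *\<^sub>C b) \<le> norm a * norm b * K"
    by (rule exI[of _ 1]) simp
qed (simp_all add: scaleC_add_left scaleC_add_right scaleC_scaleR,
    simp add: scaleR_scaleC scaleC_scaleC scaleR_conv_of_real)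

interpretation scaleC: bounded_bilinear "scaleC :: complex \<Rightarrow> 'a::complex_inner \<Rightarrow> 'a"
  by (rule bounded_bilinear_scaleC)

lemma norm_add_square:
  "(norm (x + y))\<^sup>2 = (norm x)\<^sup>2 + (norm y)\<^sup>2 + 2 * Re (cinner x y)"
  by (simp add: power2_norm_eq_inner inner_add_left inner_add_right inner_commute
      inner_eq_Re_cinner[symmetric])

lemma norm_add_Pythagorean_complex:
  assumes "cinner x y = 0" shows "(norm (x + y))\<^sup>2 = (norm x)\<^sup>2 + (norm y)\<^sup>2"
  using assms by (simp add: norm_add_square)

lemma cinner_eq_zero_commute: "cinner x y = 0 \<longleftrightarrow> cinner y x = 0"
  by (metis cinner_commute complex_cnj_zero)

lemma cinner_self_eq_zero [simp]: "cinner x x = 0 \<longleftrightarrow> x = 0"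
  by (simp add: cinner_self)

lemma eq_if_cinner_right_eq: assumes "\<And>x. cinner x y = cinner x z" shows "y = z"
proof -
  have "cinner (y - z) (y - z) = 0" using assms by (simp add: cinner.diff_right)
  then show ?thesis by simp
qed


section \<open>Bounded complex-linear operators\<close>

lemma bounded_clinearI:
  assumes "\<And>x y. T (x + y) = T x + T y" "\<And>c x. T (c *\<^sub>C x) = c *\<^sub>C T x"
    and "\<And>x. norm (T x) \<le> K * norm x"
  shows "bounded_clinear T"
  unfolding bounded_clinear_def
  by (auto intro!: bounded_linear_intro[where K = K] simp: assms scaleR_scaleC mult.commute)

lemma bounded_clinear_scaleC: "bounded_clinear T \<Longrightarrow> T (c *\<^sub>C x) = c *\<^sub>C T x"
  by (simp add: bounded_clinear_def)

lemma bounded_clinear_imp_bounded_linear: "bounded_clinear T \<Longrightarrow> bounded_linear T"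
  by (simp add: bounded_clinear_def)

lemmas bounded_clinear_add = linear_add[OF bounded_linear.linear[OF bounded_clinear_imp_bounded_linear]]
lemmas bounded_clinear_diff = linear_diff[OF bounded_linear.linear[OF bounded_clinear_imp_bounded_linear]]
lemmas bounded_clinear_sum = linear_sum[OF bounded_linear.linear[OF bounded_clinear_imp_bounded_linear]]
lemmas bounded_clinear_zero = linear_0[OF bounded_linear.linear[OF bounded_clinear_imp_bounded_linear]]
lemmas bounded_clinear_tendsto = bounded_linear.tendsto[OF bounded_clinear_imp_bounded_linear]

lemma bounded_clinear_bound:
  assumes "bounded_clinear T"
  obtains K where "0 < K" "\<And>x. norm (T x) \<le> K * norm x"
  using bounded_linear.pos_bounded[OF bounded_clinear_imp_bounded_linear[OF assms]]
  by (metis mult.commute)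

lemma bounded_clinear_id: "bounded_clinear (\<lambda>x. x)"
  by (rule bounded_clinearI[where K = 1]) auto

lemma bounded_clinear_comp:
  assumes "bounded_clinear S" "bounded_clinear T" shows "bounded_clinear (\<lambda>x. S (T x))"
  using assms bounded_linear_compose unfolding bounded_clinear_def by auto

lemma bounded_clinear_plus:
  assumes "bounded_clinear S" "bounded_clinear T" shows "bounded_clinear (\<lambda>x. S x + T x)"
  using assms bounded_linear_add unfolding bounded_clinear_def by (auto simp: scaleC_add_right)

lemma bounded_clinear_minus:
  assumes "bounded_clinear S" "bounded_clinear T" shows "bounded_clinear (\<lambda>x. S x - T x)"
  using assms bounded_linear_sub unfolding bounded_clinear_def by (auto simp: scaleC.diff_right)

text \<open>The inner map \<open>T\<close> and the factor \<open>c\<close> let one lemma serve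
  projections, the map in the dimension count and the correction term in the dense-range
  construction.\<close>

lemma bounded_clinear_rank_one:
  assumes "bounded_clinear T"
  shows "bounded_clinear (\<lambda>x. (c * cinner (T x) y) *\<^sub>C z)"
proof -
  obtain K where K: "\<And>x. norm (T x) \<le> K * norm x" using bounded_clinear_bound[OF assms] by blast
  show ?thesis
  proof (rule bounded_clinearI[where K = "cmod c * (K * norm y) * norm z"])
    fix x
    have "cmod (cinner (T x) y) \<le> K * norm x * norm y"
      by (rule order_trans[OF norm_cinner_le]) (simp add: K mult_right_mono)
    from mult_left_mono[OF this, of "cmod c * norm z"]
    show "norm ((c * cinner (T x) y) *\<^sub>C z) \<le> cmod c * (K * norm y) * norm z * norm x"
      by (simp add: norm_mult mult_ac)
  qed (simp_all add: bounded_clinear_add[OF assms] bounded_clinear_scaleC[OF assms] cinner_add_left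
      cinner_scaleC_left scaleC_add_left scaleC_scaleC ring_distribs mult_ac)
qed

lemma bounded_clinear_zero_fun: "bounded_clinear (\<lambda>x. 0)"
  by (rule bounded_clinearI[where K = 0]) auto

lemma bounded_clinear_fun_sum:
  assumes "\<And>i. i \<in> I \<Longrightarrow> bounded_clinear (T i)"
  shows "bounded_clinear (\<lambda>x. \<Sum>i\<in>I. T i x)"
  using assms
  by (induction I rule: infinite_finite_induct)
    (auto intro: bounded_clinear_plus bounded_clinear_zero_fun)

lemma compact_operator_comp:
  fixes S :: "'c::complex_inner \<Rightarrow> 'a::complex_inner"
  assumes "compact_operator A" "bounded_clinear S"
  shows "compact_operator (\<lambda>x. A (S x))"
  unfolding compact_operator_def
proof (intro conjI allI impI)
  show "bounded_clinear (\<lambda>x. A (S x))"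
    using assms bounded_clinear_comp compact_operator_def by blast
  fix T :: "'c set" assume "bounded T"
  then have "bounded (S ` T)"
    using assms(2) bounded_linear_image bounded_clinear_imp_bounded_linear by blast
  then have "compact (closure (A ` S ` T))" using assms(1) compact_operator_def by blast
  then show "compact (closure ((\<lambda>x. A (S x)) ` T))" by (simp add: image_image)
qed


section \<open>Orthonormal families\<close>

definition orthonormal_on :: "'i set \<Rightarrow> ('i \<Rightarrow> 'a::complex_inner) \<Rightarrow> bool" where
  "orthonormal_on I e \<longleftrightarrow> (\<forall>i\<in>I. \<forall>j\<in>I. cinner (e i) (e j) = (if i = j then 1 else 0))"

lemma orthonormal_onD:
  "orthonormal_on I e \<Longrightarrow> i \<in> I \<Longrightarrow> j \<in> I \<Longrightarrow> cinner (e i) (e j) = (if i = j then 1 else 0)"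
  by (simp add: orthonormal_on_def)

lemma orthonormal_on_subset: "orthonormal_on I e \<Longrightarrow> J \<subseteq> I \<Longrightarrow> orthonormal_on J e"
  unfolding orthonormal_on_def by blast

lemma orthonormal_on_norm:
  assumes "orthonormal_on I e" "i \<in> I" shows "norm (e i) = 1"
proof -
  have "complex_of_real ((norm (e i))\<^sup>2) = 1"
    using orthonormal_onD[OF assms assms(2)] by (simp add: cinner_self)
  then have "(norm (e i))\<^sup>2 = 1\<^sup>2" using of_real_eq_1_iff by fastforce
  then show ?thesis by (rule power2_eq_imp_eq) auto
qed

lemma orthonormal_on_comp_inj:
  "orthonormal_on (s ` I) e \<Longrightarrow> inj_on s I \<Longrightarrow> orthonormal_on I (\<lambda>i. e (s i))"
  unfolding orthonormal_on_def inj_on_def by auto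

lemma cinner_orthonormal_sum:
  assumes "orthonormal_on I e" "finite J" "J \<subseteq> I" "i \<in> I"
  shows "cinner (\<Sum>j\<in>J. c j *\<^sub>C e j) (e i) = (if i \<in> J then c i else 0)"
proof -
  have "cinner (\<Sum>j\<in>J. c j *\<^sub>C e j) (e i) = (\<Sum>j\<in>J. if j = i then c j else 0)"
    unfolding cinner.sum_left cinner_scaleC_left
    using assms orthonormal_onD[OF assms(1)] by (intro sum.cong) auto
  then show ?thesis using assms(2) by simp
qed

lemma norm_orthonormal_sum:
  assumes "orthonormal_on I e" "finite I"
  shows "(norm (\<Sum>i\<in>I. c i *\<^sub>C e i))\<^sup>2 = (\<Sum>i\<in>I. (cmod (c i))\<^sup>2)"
proof -
  let ?s = "\<Sum>i\<in>I. c i *\<^sub>C e i"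
  have "complex_of_real ((norm ?s)\<^sup>2) = (\<Sum>i\<in>I. cnj (c i) * cinner ?s (e i))"
    unfolding cinner_self[symmetric] cinner.sum_right cinner_scaleC_right ..
  also have "\<dots> = complex_of_real (\<Sum>i\<in>I. (cmod (c i))\<^sup>2)"
    using assms
    by (simp add: cinner_orthonormal_sum[OF assms(1,2) subset_refl] complex_norm_square
        mult.commute[of "cnj _"] del: of_real_power cong: sum.cong)
  finally show ?thesis using of_real_eq_iff by blast
qed

definition proj_on :: "'i set \<Rightarrow> ('i \<Rightarrow> 'a::complex_inner) \<Rightarrow> 'a \<Rightarrow> 'a" where
  "proj_on I e x = (\<Sum>i\<in>I. cinner x (e i) *\<^sub>C e i)"

lemma bounded_clinear_proj_on: "bounded_clinear (proj_on I e)"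
  unfolding proj_on_def
  using bounded_clinear_fun_sum[OF bounded_clinear_rank_one[OF bounded_clinear_id, of 1]] by simp

text \<open>The larger index set \<open>I\<close> is there for indices outside \<open>J\<close>: the
  projection onto the first \<open>N\<close> vectors has no component along the vectors from
  \<open>N\<close> on.\<close>

lemma cinner_proj_on:
  assumes "orthonormal_on I e" "finite J" "J \<subseteq> I" "i \<in> I"
  shows "cinner (proj_on J e x) (e i) = (if i \<in> J then cinner x (e i) else 0)"
  unfolding proj_on_def by (rule cinner_orthonormal_sum[OF assms])

lemma cinner_diff_proj_on:
  assumes "orthonormal_on I e" "finite I" "i \<in> I"
  shows "cinner (x - proj_on I e x) (e i) = 0"
  using assms by (simp add: cinner.diff_left cinner_proj_on[OF assms(1,2) subset_refl])

lemma cinner_proj_on_eq_zero: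
  "(\<And>i. i \<in> I \<Longrightarrow> cinner x (e i) = 0) \<Longrightarrow> cinner x (proj_on I e y) = 0"
  unfolding proj_on_def by (simp add: cinner.sum_right cinner_scaleC_right)

lemma proj_on_eq_zero: "(\<And>i. i \<in> I \<Longrightarrow> cinner x (e i) = 0) \<Longrightarrow> proj_on I e x = 0"
  unfolding proj_on_def by simp

lemma cinner_proj_on_swap: "cinner (proj_on I e x) y = cinner x (proj_on I e y)"
  unfolding proj_on_def cinner.sum_left cinner.sum_right cinner_scaleC_left cinner_scaleC_right
  by (metis (no_types, lifting) cinner_commute mult.commute)

lemma proj_on_idem:
  assumes "orthonormal_on I e" "finite I"
  shows "proj_on I e (proj_on I e x) = proj_on I e x"
  unfolding proj_on_def[of I e "proj_on I e x"]
  using cinner_proj_on[OF assms subset_refl] by (simp add: proj_on_def cong: sum.cong)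

lemma norm_proj_on:
  assumes "orthonormal_on I e" "finite I"
  shows "(norm (proj_on I e x))\<^sup>2 = (\<Sum>i\<in>I. (cmod (cinner x (e i)))\<^sup>2)"
  unfolding proj_on_def by (rule norm_orthonormal_sum[OF assms])

lemma Bessel_finite:
  assumes "orthonormal_on I e" "finite I"
  shows "(\<Sum>i\<in>I. (cmod (cinner x (e i)))\<^sup>2) \<le> (norm x)\<^sup>2"
proof -
  have "(norm (x - proj_on I e x + proj_on I e x))\<^sup>2
    = (norm (x - proj_on I e x))\<^sup>2 + (norm (proj_on I e x))\<^sup>2"
    by (rule norm_add_Pythagorean_complex, rule cinner_proj_on_eq_zero)
      (rule cinner_diff_proj_on[OF assms])
  then show ?thesis by (simp add: norm_proj_on[OF assms, symmetric])
qed

lemma norm_proj_on_le: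
  assumes "orthonormal_on I e" "finite I" shows "norm (proj_on I e x) \<le> norm x"
  using Bessel_finite[OF assms, of x] norm_proj_on[OF assms, of x]
  by (metis norm_ge_zero power2_le_imp_le)

lemma proj_on_in_span: "proj_on I e x \<in> complex_vector.span (e ` I)"
  unfolding proj_on_def
  by (intro complex_vector.span_sum complex_vector.span_scale complex_vector.span_base) auto

lemma proj_on_span:
  assumes "orthonormal_on I e" "finite I" "x \<in> complex_vector.span (e ` I)"
  shows "proj_on I e x = x"
  using assms(3)
proof (induction rule: complex_vector.span_induct_alt)
  case base
  show ?case by (simp add: proj_on_def)
next
  case (step c x y)
  then obtain i where i: "i \<in> I" "x = e i" by auto
  have "proj_on I e (e i) = (\<Sum>j\<in>I. if j = i then e j else 0)"
    unfolding proj_on_def using orthonormal_onD[OF assms(1)] i(1)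
    by (intro sum.cong) (auto simp: scaleC_one)
  then have "proj_on I e (e i) = e i" using i(1) assms(2) by simp
  then show ?case
    using step i by (simp add: bounded_clinear_add[OF bounded_clinear_proj_on]
        bounded_clinear_scaleC[OF bounded_clinear_proj_on])
qed

text \<open>Infinite dimension enters the proof through this lemma: \<open>n\<close> vectors do not
  span, and the residual of a vector outside their span can be normalised.\<close>

lemma exists_unit_orthogonal:
  fixes e :: "nat \<Rightarrow> 'a::complex_inner"
  assumes "\<not> cfinite_dim (UNIV :: 'a set)" "orthonormal_on {..<n} e"
  obtains u where "norm u = 1" "\<And>i. i < n \<Longrightarrow> cinner u (e i) = 0"
proof -
  obtain v where v: "v \<notin> complex_vector.span (e ` {..<n})"
    using assms(1) unfolding cfinite_dim_def by blast
  define r where "r = v - proj_on {..<n} e v"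
  have "r \<noteq> 0" using v proj_on_in_span[of "{..<n}" e v] by (auto simp: r_def)
  show ?thesis
  proof
    show "norm (complex_of_real (1 / norm r) *\<^sub>C r) = 1" using \<open>r \<noteq> 0\<close> by (simp add: norm_divide)
    show "cinner (complex_of_real (1 / norm r) *\<^sub>C r) (e i) = 0" if "i < n" for i
      using cinner_diff_proj_on[OF assms(2), of i v] that by (simp add: cinner_scaleC_left r_def)
  qed
qed

text \<open>Gram-Schmidt, one vector of \<open>F\<close> at a time; a vector with zero residual adds
  nothing, so \<open>m\<close> may be smaller than the cardinality of \<open>F\<close>.\<close>

lemma orthonormal_basis_of_finite:
  fixes F :: "'a::complex_inner set"
  assumes "finite F"
  obtains m and u :: "nat \<Rightarrow> 'a"
  where "orthonormal_on {..<m} u" "\<And>x. x \<in> F \<Longrightarrow> proj_on {..<m} u x = x"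
proof -
  have "\<exists>m (u :: nat \<Rightarrow> 'a). orthonormal_on {..<m} u \<and> (\<forall>x\<in>F. proj_on {..<m} u x = x)"
    using assms
  proof (induction F)
    case empty
    show ?case by (rule exI[of _ 0]) (simp add: orthonormal_on_def)
  next
    case (insert x F)
    then obtain m and u :: "nat \<Rightarrow> 'a"
      where u: "orthonormal_on {..<m} u" "\<And>x. x \<in> F \<Longrightarrow> proj_on {..<m} u x = x" by blast
    define r where "r = x - proj_on {..<m} u x"
    show ?case
    proof (cases "r = 0")
      case True
      then show ?thesis using u by (intro exI[of _ m] exI[of _ u]) (auto simp: r_def)
    next
      case False
      define w where "w = complex_of_real (1 / norm r) *\<^sub>C r"
      have nw: "norm w = 1" using False by (simp add: w_def norm_divide)
      have w: "cinner w (u i) = 0" if "i < m" for i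
        using cinner_diff_proj_on[OF u(1), of i x] that
        by (simp add: w_def r_def cinner_scaleC_left)
      let ?u = "u(m := w)"
      have ON: "orthonormal_on {..<Suc m} ?u"
        using u(1) w orthonormal_on_norm[OF u(1)] unfolding orthonormal_on_def
        by (auto simp: less_Suc_eq cinner_self nw cinner_eq_zero_commute[of "u _" w])
      have sub: "u ` {..<m} \<subseteq> ?u ` {..<Suc m}"
        by (auto intro!: rev_image_eqI[of _ "{..<Suc m}"])
      have span: "proj_on {..<m} u y \<in> complex_vector.span (?u ` {..<Suc m})" for y
        using proj_on_in_span[of "{..<m}" u y] complex_vector.span_mono[OF sub] by blast
      have "w \<in> complex_vector.span (?u ` {..<Suc m})"
        by (intro complex_vector.span_base rev_image_eqI[of m]) auto
      then have "proj_on {..<m} u x + complex_of_real (norm r) *\<^sub>C w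
          \<in> complex_vector.span (?u ` {..<Suc m})"
        by (intro complex_vector.span_add complex_vector.span_scale span)
      also have "proj_on {..<m} u x + complex_of_real (norm r) *\<^sub>C w = x"
        using False by (simp add: w_def scaleC_scaleC scaleC_one)
          (simp add: r_def)
      finally have "x \<in> complex_vector.span (?u ` {..<Suc m})" .
      moreover have "y \<in> complex_vector.span (?u ` {..<Suc m})" if "y \<in> F" for y
        using span[of y] u(2)[OF that] by simp
      ultimately have "\<forall>y\<in>insert x F. proj_on {..<Suc m} ?u y = y"
        using proj_on_span[OF ON] by blast
      then show ?thesis using ON by blast
    qed
  qed
  then show ?thesis using that by blast
qed

lemma orthonormal_on_inj: "orthonormal_on I e \<Longrightarrow> inj_on e I"
  by (metis inj_onI orthonormal_onD zero_neq_one)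

lemma orthonormal_on_independent:
  assumes "orthonormal_on I e" shows "complex_vector.independent (e ` I)"
  unfolding complex_vector.dependent_explicit
proof clarify
  fix t u v assume t: "finite t" "t \<subseteq> e ` I" "(\<Sum>v\<in>t. u v *\<^sub>C v) = 0" "v \<in> t" "u v \<noteq> 0"
  have "cinner (\<Sum>v\<in>t. u v *\<^sub>C v) v = (\<Sum>v'\<in>t. if v' = v then u v else 0)"
    unfolding cinner.sum_left cinner_scaleC_left
    by (rule sum.cong[OF refl])
      (use t(2,4) orthonormal_onD[OF assms] in \<open>auto simp: subset_iff image_iff; metis mult_eq_0_iff\<close>)
  then show False using t by simp
qed

text \<open>Otherwise the map \<open>x \<mapsto> \<Sum>i<n. cinner (S x) (w i) *\<^sub>C g i\<close> would embed an
  \<open>(n + 1)\<close>-dimensional space into an \<open>n\<close>-dimensional one.\<close>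

lemma exists_orthogonal_in_span:
  fixes g :: "nat \<Rightarrow> 'a::complex_inner"
  assumes g: "orthonormal_on {..n} g" and S: "bounded_clinear S"
  obtains x where "x \<in> complex_vector.span (g ` {..n})" "x \<noteq> 0"
    "\<And>i. i < n \<Longrightarrow> cinner (S x) (w i) = 0"
proof -
  define T where "T x = (\<Sum>i<n. cinner (S x) (w i) *\<^sub>C g i)" for x
  have T: "bounded_clinear T"
    unfolding T_def
    using bounded_clinear_fun_sum[OF bounded_clinear_rank_one[OF S, of 1]] by simp
  have g': "orthonormal_on {..<n} g" by (rule orthonormal_on_subset[OF g]) auto
  note inj = orthonormal_on_inj[OF g] and ind = orthonormal_on_independent[OF g]
  interpret vector_space_pair "scaleC :: complex \<Rightarrow> 'a \<Rightarrow> 'a" "scaleC :: complex \<Rightarrow> 'a \<Rightarrow> 'a"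
    by unfold_locales
  have lin: "Vector_Spaces.linear scaleC scaleC T"
    unfolding Vector_Spaces.linear_iff
    using complex_vector.vector_space_axioms bounded_clinear_add[OF T] bounded_clinear_scaleC[OF T]
    by blast
  have "\<not> inj_on T (complex_vector.span (g ` {..n}))"
  proof
    assume inj_T: "inj_on T (complex_vector.span (g ` {..n}))"
    have "T x \<in> complex_vector.span (g ` {..<n})" for x
      unfolding T_def
      by (intro complex_vector.span_sum complex_vector.span_scale complex_vector.span_base) auto
    then have "card (T ` g ` {..n}) \<le> card (g ` {..<n})"
      using complex_vector.independent_span_bound[of "g ` {..<n}" "T ` g ` {..n}"]
        linear_independent_injective_image[OF lin ind inj_T] by blast
    also have "\<dots> \<le> n" using card_image_le[of "{..<n}" g] by simp
    also have "card (T ` g ` {..n}) = Suc n"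
      using card_image[OF inj_on_subset[OF inj_T complex_vector.span_superset]] card_image[OF inj]
      by simp
    finally show False by simp
  qed
  then obtain x y where xy: "x \<in> complex_vector.span (g ` {..n})"
    "y \<in> complex_vector.span (g ` {..n})" "x \<noteq> y" "T x = T y"
    unfolding inj_on_def by blast
  show ?thesis
  proof
    show "x - y \<in> complex_vector.span (g ` {..n})" using xy by (intro complex_vector.span_diff)
    show "x - y \<noteq> 0" using xy by simp
    show "cinner (S (x - y)) (w i) = 0" if "i < n" for i
    proof -
      have "T (x - y) = 0" using xy(4) by (simp add: bounded_clinear_diff[OF T])
      then have "cinner (T (x - y)) (g i) = 0" by simp
      then show ?thesis
        using that cinner_orthonormal_sum[OF g' _ subset_refl, of i] by (simp add: T_def)
    qed
  qed
qed


section \<open>Diagonal operators\<close>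

text \<open>Since the coefficients are real, the adjoint is the same expression with
  \<open>e\<close> and \<open>f\<close> exchanged. Neither family has to be complete: vectors
  orthogonal to all \<open>e n\<close> are sent to 0.\<close>

definition diag_op ::
  "(nat \<Rightarrow> real) \<Rightarrow> (nat \<Rightarrow> 'a::chilbert_space) \<Rightarrow> (nat \<Rightarrow> 'b::chilbert_space) \<Rightarrow> 'a \<Rightarrow> 'b" where
  "diag_op c e f x = (\<Sum>n. (complex_of_real (c n) * cinner x (e n)) *\<^sub>C f n)"

lemma summable_orthonormal:
  fixes f :: "nat \<Rightarrow> 'a::chilbert_space"
  assumes f: "orthonormal_on UNIV f" and d: "summable (\<lambda>n. (cmod (d n))\<^sup>2)"
  shows "summable (\<lambda>n. d n *\<^sub>C f n)"
  unfolding summable_Cauchy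
proof (intro allI impI)
  fix r :: real assume "r > 0"
  then obtain N where N: "\<And>m n. m \<ge> N \<Longrightarrow> norm (\<Sum>n=m..<n. (cmod (d n))\<^sup>2) < r\<^sup>2"
    using d unfolding summable_Cauchy by (meson zero_less_power)
  have "norm (\<Sum>n=m..<n. d n *\<^sub>C f n) < r" if "m \<ge> N" for m n
  proof (rule power2_less_imp_less)
    show "(norm (\<Sum>n=m..<n. d n *\<^sub>C f n))\<^sup>2 < r\<^sup>2"
      unfolding norm_orthonormal_sum[OF orthonormal_on_subset[OF f subset_UNIV] finite_atLeastLessThan]
      using N[OF that, of n] by (simp add: sum_nonneg)
  qed (use \<open>r > 0\<close> in simp)
  then show "\<exists>N. \<forall>m\<ge>N. \<forall>n. norm (\<Sum>n=m..<n. d n *\<^sub>C f n) < r" by blast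
qed

lemma norm_suminf_orthonormal:
  fixes f :: "nat \<Rightarrow> 'a::chilbert_space"
  assumes f: "orthonormal_on UNIV f" and d: "summable (\<lambda>n. (cmod (d n))\<^sup>2)"
  shows "(norm (\<Sum>n. d n *\<^sub>C f n))\<^sup>2 = (\<Sum>n. (cmod (d n))\<^sup>2)"
proof -
  have "(\<lambda>N. (norm (\<Sum>n<N. d n *\<^sub>C f n))\<^sup>2) \<longlonglongrightarrow> (norm (\<Sum>n. d n *\<^sub>C f n))\<^sup>2"
    by (intro tendsto_intros summable_LIMSEQ summable_orthonormal[OF assms])
  moreover have "(norm (\<Sum>n<N. d n *\<^sub>C f n))\<^sup>2 = (\<Sum>n<N. (cmod (d n))\<^sup>2)" for N
    by (rule norm_orthonormal_sum[OF orthonormal_on_subset[OF f subset_UNIV] finite_lessThan])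
  ultimately show ?thesis using summable_LIMSEQ[OF d] LIMSEQ_unique by simp blast
qed

lemma Bessel:
  fixes e :: "nat \<Rightarrow> 'a::complex_inner"
  assumes "orthonormal_on UNIV e"
  shows "summable (\<lambda>n. (cmod (cinner x (e n)))\<^sup>2)"
    and "(\<Sum>n. (cmod (cinner x (e n)))\<^sup>2) \<le> (norm x)\<^sup>2"
proof -
  have le: "(\<Sum>n<N. (cmod (cinner x (e n)))\<^sup>2) \<le> (norm x)\<^sup>2" for N
    by (rule Bessel_finite[OF orthonormal_on_subset[OF assms subset_UNIV] finite_lessThan])
  show S: "summable (\<lambda>n. (cmod (cinner x (e n)))\<^sup>2)"
    by (rule summableI_nonneg_bounded[OF _ le]) simp
  show "(\<Sum>n. (cmod (cinner x (e n)))\<^sup>2) \<le> (norm x)\<^sup>2"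
    by (rule suminf_le_const[OF S le])
qed

context
  fixes c :: "nat \<Rightarrow> real" and e :: "nat \<Rightarrow> 'a::chilbert_space" and f :: "nat \<Rightarrow> 'b::chilbert_space"
    and K :: real
  assumes e: "orthonormal_on UNIV e" and f: "orthonormal_on UNIV f"
begin

text \<open>The bound concerns only indices at which \<open>x\<close> has a nonzero coefficient. For
  \<open>x\<close> orthogonal to \<open>e 0\<close>, ..., \<open>e (n - 1)\<close> and decreasing
  nonnegative \<open>c\<close>, the constant can therefore be \<open>c n\<close>.\<close>

lemma summable_diag_op_coeff:
  assumes c: "\<And>n. cinner x (e n) \<noteq> 0 \<Longrightarrow> \<bar>c n\<bar> \<le> K"
  shows "summable (\<lambda>n. (cmod (complex_of_real (c n) * cinner x (e n)))\<^sup>2)"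
    and "(\<Sum>n. (cmod (complex_of_real (c n) * cinner x (e n)))\<^sup>2) \<le> K\<^sup>2 * (norm x)\<^sup>2"
proof -
  have le: "(cmod (complex_of_real (c n) * cinner x (e n)))\<^sup>2 \<le> K\<^sup>2 * (cmod (cinner x (e n)))\<^sup>2" for n
    using power_mono[OF c[of n], of 2] by (cases "cinner x (e n) = 0")
      (auto simp: norm_mult power_mult_distrib intro!: mult_right_mono)
  note B = summable_mult[OF Bessel(1)[OF e], of "K\<^sup>2" x]
  show S: "summable (\<lambda>n. (cmod (complex_of_real (c n) * cinner x (e n)))\<^sup>2)"
    by (rule summable_comparison_test'[OF B, of 0]) (use le in simp)
  have "(\<Sum>n. (cmod (complex_of_real (c n) * cinner x (e n)))\<^sup>2)
      \<le> K\<^sup>2 * (\<Sum>n. (cmod (cinner x (e n)))\<^sup>2)"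
    unfolding suminf_mult[OF Bessel(1)[OF e], symmetric] by (rule suminf_le[OF le S B])
  also have "\<dots> \<le> K\<^sup>2 * (norm x)\<^sup>2" by (intro mult_left_mono Bessel(2)[OF e]) simp
  finally show "(\<Sum>n. (cmod (complex_of_real (c n) * cinner x (e n)))\<^sup>2) \<le> K\<^sup>2 * (norm x)\<^sup>2" .
qed

lemma norm_diag_op_le:
  assumes "\<And>n. cinner x (e n) \<noteq> 0 \<Longrightarrow> \<bar>c n\<bar> \<le> K" and "0 \<le> K"
  shows "norm (diag_op c e f x) \<le> K * norm x"
proof (rule power2_le_imp_le)
  show "(norm (diag_op c e f x))\<^sup>2 \<le> (K * norm x)\<^sup>2"
    using summable_diag_op_coeff[OF assms(1)]
    by (simp add: diag_op_def norm_suminf_orthonormal[OF f] power_mult_distrib)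
qed (use assms in simp)

context
  assumes c: "\<And>n. \<bar>c n\<bar> \<le> K"
begin

lemma diag_op_sums: "(\<lambda>n. (complex_of_real (c n) * cinner x (e n)) *\<^sub>C f n) sums diag_op c e f x"
  unfolding diag_op_def
  by (intro summable_sums summable_orthonormal[OF f] summable_diag_op_coeff(1) c)

lemma bounded_clinear_diag_op: "bounded_clinear (diag_op c e f)"
proof (rule bounded_clinearI[where K = K])
  have "0 \<le> K" using c[of 0] by simp
  then show "norm (diag_op c e f x) \<le> K * norm x" for x by (rule norm_diag_op_le[OF c])
  show "diag_op c e f (x + y) = diag_op c e f x + diag_op c e f y" for x y
  proof (rule sums_unique2[OF diag_op_sums])
    show "(\<lambda>n. (complex_of_real (c n) * cinner (x + y) (e n)) *\<^sub>C f n)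
        sums (diag_op c e f x + diag_op c e f y)"
      using sums_add[OF diag_op_sums[of x] diag_op_sums[of y]]
      by (simp add: cinner_add_left ring_distribs scaleC_add_left)
  qed
  show "diag_op c e f (d *\<^sub>C x) = d *\<^sub>C diag_op c e f x" for d x
  proof (rule sums_unique2[OF diag_op_sums])
    show "(\<lambda>n. (complex_of_real (c n) * cinner (d *\<^sub>C x) (e n)) *\<^sub>C f n)
        sums (d *\<^sub>C diag_op c e f x)"
      using bounded_linear.sums[OF scaleC.bounded_linear_right[of d] diag_op_sums[of x]]
      by (simp add: cinner_scaleC_left scaleC_scaleC mult_ac)
  qed
qed

lemma cinner_diag_op_sums:
  "(\<lambda>n. complex_of_real (c n) * cinner x (e n) * cinner (f n) y) sums cinner (diag_op c e f x) y"
  using bounded_linear.sums[OF cinner.bounded_linear_left diag_op_sums]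
  by (simp add: cinner_scaleC_left)

lemma cinner_diag_op: "cinner (diag_op c e f x) (f n) = complex_of_real (c n) * cinner x (e n)"
proof -
  have "(\<lambda>m. if m = n then complex_of_real (c m) * cinner x (e m) else 0)
      sums (complex_of_real (c n) * cinner x (e n))"
    using sums_single[of n "\<lambda>m. complex_of_real (c m) * cinner x (e m)"] by simp
  also have "(\<lambda>m. if m = n then complex_of_real (c m) * cinner x (e m) else 0)
      = (\<lambda>m. complex_of_real (c m) * cinner x (e m) * cinner (f m) (f n))"
    by (auto simp: orthonormal_onD[OF f])
  finally show ?thesis using cinner_diag_op_sums sums_unique2 by blast
qed

end

lemma diag_op_basis: "diag_op c e f (e n) = complex_of_real (c n) *\<^sub>C f n"
proof -
  have "(\<lambda>m. (complex_of_real (c m) * cinner (e n) (e m)) *\<^sub>C f m)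
      = (\<lambda>m. if m = n then complex_of_real (c m) *\<^sub>C f m else 0)"
    by (auto simp: orthonormal_onD[OF e])
  then show ?thesis
    unfolding diag_op_def using sums_single[of n "\<lambda>m. complex_of_real (c m) *\<^sub>C f m"]
    by (simp add: sums_iff)
qed

lemma diag_op_eq_zero: "(\<And>n. cinner x (e n) = 0) \<Longrightarrow> diag_op c e f x = 0"
  by (simp add: diag_op_def)

end

lemma cinner_diag_op_swap:
  assumes "orthonormal_on UNIV e" "orthonormal_on UNIV f" "\<And>n. \<bar>c n\<bar> \<le> K"
  shows "cinner (diag_op c e f x) y = cinner x (diag_op c f e y)"
proof -
  have "cinner x (diag_op c f e y) = cnj (cinner (diag_op c f e y) x)"
    by (rule cinner_commute)
  moreover have "(\<lambda>n. cnj (complex_of_real (c n) * cinner y (f n) * cinner (e n) x))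
      sums cnj (cinner (diag_op c f e y) x)"
    unfolding sums_cnj by (rule cinner_diag_op_sums[OF assms(2,1,3)])
  moreover have "(\<lambda>n. cnj (complex_of_real (c n) * cinner y (f n) * cinner (e n) x))
      = (\<lambda>n. complex_of_real (c n) * cinner x (e n) * cinner (f n) y)"
    by (simp add: cinner_commute[symmetric] mult_ac)
  ultimately show ?thesis
    using sums_unique2[OF cinner_diag_op_sums[OF assms]] by simp
qed

lemma diag_op_comp:
  assumes "orthonormal_on UNIV e" "orthonormal_on UNIV f" "\<And>n. \<bar>c n\<bar> \<le> K"
  shows "diag_op d f h (diag_op c e f x) = diag_op (\<lambda>n. d n * c n) e h x"
  unfolding diag_op_def[of d f h] cinner_diag_op[OF assms] by (simp add: diag_op_def mult.assoc)

text \<open>Splitting \<open>x\<close> into its expansion \<open>p\<close> along \<open>g\<close>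
  and a remainder orthogonal to \<open>g\<close> stands in for completeness of \<open>g\<close>;
  \<open>compl\<close> takes care of the remainder, which for a singular value decomposition lies in
  the kernel.\<close>

lemma bounded_clinear_eqI_orthonormal:
  fixes g :: "nat \<Rightarrow> 'a::chilbert_space"
  assumes S: "bounded_clinear S" and T: "bounded_clinear T" and g: "orthonormal_on UNIV g"
    and basis: "\<And>n. S (g n) = T (g n)"
    and compl: "\<And>x. (\<And>n. cinner x (g n) = 0) \<Longrightarrow> S x = T x"
  shows "S = T"
proof
  fix x
  define p where "p = diag_op (\<lambda>_. 1) g g x"
  have sums: "(\<lambda>n. cinner x (g n) *\<^sub>C g n) sums p"
    using diag_op_sums[OF g g, of "\<lambda>_. 1" 1 x] by (simp add: p_def)
  have "(\<lambda>n. S (cinner x (g n) *\<^sub>C g n)) sums S p" "(\<lambda>n. T (cinner x (g n) *\<^sub>C g n)) sums T p"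
    using bounded_linear.sums[OF bounded_clinear_imp_bounded_linear[OF S] sums]
      bounded_linear.sums[OF bounded_clinear_imp_bounded_linear[OF T] sums] .
  then have "S p = T p"
    using sums_unique2 by (simp add: bounded_clinear_scaleC[OF S] bounded_clinear_scaleC[OF T] basis)
  moreover have "S (x - p) = T (x - p)"
    using cinner_diag_op[OF g g, of "\<lambda>_. 1" 1 x] by (intro compl) (simp add: cinner.diff_left p_def)
  ultimately show "S x = T x"
    by (simp add: bounded_clinear_diff[OF S] bounded_clinear_diff[OF T])
qed

lemma tendsto_proj_on:
  fixes e :: "nat \<Rightarrow> 'a::chilbert_space"
  assumes e: "orthonormal_on UNIV e" and complete: "\<And>x. (\<And>n. cinner x (e n) = 0) \<Longrightarrow> x = 0"
  shows "(\<lambda>N. proj_on {..<N} e x) \<longlonglongrightarrow> x"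
proof -
  have "bounded_clinear (diag_op (\<lambda>_. 1) e e)"
    by (rule bounded_clinear_diag_op[OF e e, of _ 1]) simp
  then have "diag_op (\<lambda>_. 1) e e = (\<lambda>x. x)"
  proof (rule bounded_clinear_eqI_orthonormal[OF _ bounded_clinear_id e])
    show "diag_op (\<lambda>_. 1) e e x = x" if "\<And>n. cinner x (e n) = 0" for x
      using complete[OF that] diag_op_eq_zero[OF e e that] by simp
  qed (simp add: diag_op_basis[OF e e] scaleC_one)
  then show ?thesis
    using diag_op_sums[OF e e, of "\<lambda>_. 1" 1 x] by (simp add: sums_def proj_on_def)
qed

text \<open>By Pythagoras, since \<open>a n\<close> is the smallest of \<open>a 0\<close>, ...,
  \<open>a n\<close>. This is the lower half of the minimax principle;
  \<open>norm_diag_op_le_singular_value\<close> is the upper half.\<close>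

lemma span_diag_op_lower_bound:
  fixes e :: "nat \<Rightarrow> 'a::chilbert_space" and f :: "nat \<Rightarrow> 'b::chilbert_space"
  assumes e: "orthonormal_on UNIV e" and f: "orthonormal_on UNIV f" and a: "\<And>n. \<bar>a n\<bar> \<le> K"
    and dec: "decseq a" "0 \<le> a n" and x: "x \<in> complex_vector.span (e ` {..n})"
  shows "a n * norm x \<le> norm (diag_op a e f x)"
proof (rule power2_le_imp_le)
  note D = bounded_clinear_diag_op[OF e f a]
  have fn: "orthonormal_on {..n} f" and en: "orthonormal_on {..n} e"
    using orthonormal_on_subset[OF f] orthonormal_on_subset[OF e] by auto
  have px: "proj_on {..n} e x = x" by (rule proj_on_span[OF en _ x]) simp
  have "diag_op a e f (proj_on {..n} e x) = (\<Sum>i\<le>n. diag_op a e f (cinner x (e i) *\<^sub>C e i))"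
    unfolding proj_on_def by (rule bounded_clinear_sum[OF D])
  also have "\<dots> = (\<Sum>i\<le>n. (cinner x (e i) * complex_of_real (a i)) *\<^sub>C f i)"
    by (simp add: bounded_clinear_scaleC[OF D] diag_op_basis[OF e f] scaleC_scaleC)
  finally have "(norm (diag_op a e f x))\<^sup>2 = (\<Sum>i\<le>n. (cmod (cinner x (e i)) * \<bar>a i\<bar>)\<^sup>2)"
    by (simp add: norm_orthonormal_sum[OF fn] norm_mult px)
  also have "\<dots> \<ge> (\<Sum>i\<le>n. (a n)\<^sup>2 * (cmod (cinner x (e i)))\<^sup>2)"
  proof (rule sum_mono)
    fix i assume "i \<in> {..n}"
    then have "a n \<le> a i" using dec(1) by (simp add: decseqD)
    then show "(a n)\<^sup>2 * (cmod (cinner x (e i)))\<^sup>2 \<le> (cmod (cinner x (e i)) * \<bar>a i\<bar>)\<^sup>2"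
      using dec(2) by (simp add: power_mult_distrib mult.commute[of "(cmod _)\<^sup>2"] mult_right_mono power_mono)
  qed
  also have "(\<Sum>i\<le>n. (a n)\<^sup>2 * (cmod (cinner x (e i)))\<^sup>2) = (a n * norm x)\<^sup>2"
    using norm_proj_on[OF en, of x] by (simp add: px power_mult_distrib sum_distrib_left)
  finally show "(a n * norm x)\<^sup>2 \<le> (norm (diag_op a e f x))\<^sup>2" by simp
qed simp


section \<open>Singular value decomposition of compact operators\<close>

lemma compact_operator_subsequence:
  assumes A: "compact_operator A" and x: "\<And>n. norm (x n) \<le> K"
  obtains l r where "strict_mono (r :: nat \<Rightarrow> nat)" "(\<lambda>n. A (x (r n))) \<longlonglongrightarrow> l"
proof -
  have "bounded (range x)" unfolding bounded_iff using x by auto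
  then have "seq_compact (closure (A ` range x))"
    using A by (simp add: compact_operator_def compact_imp_seq_compact)
  moreover have "\<forall>n. A (x n) \<in> closure (A ` range x)"
    by (intro allI subsetD[OF closure_subset]) auto
  ultimately obtain l r where "strict_mono r" "((\<lambda>n. A (x n)) \<circ> r) \<longlonglongrightarrow> l"
    by (rule seq_compactE)
  then show ?thesis using that by (simp add: comp_def)
qed

text \<open>A maximizing sequence converges: if \<open>A (x k)\<close> is Cauchy and \<open>norm (A (x k))\<close> approaches the
  supremum, the parallelogram law forces \<open>x\<close> itself to be Cauchy.\<close>

lemma compact_operator_attains_norm:
  fixes A :: "'a::chilbert_space \<Rightarrow> 'b::chilbert_space"
  assumes A: "compact_operator A" and V: "complex_vector.subspace V" "closed V"
    and v: "v \<in> V" "norm v = 1"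
  obtains u where "u \<in> V" "norm u = 1" "\<And>x. x \<in> V \<Longrightarrow> norm (A x) \<le> norm (A u) * norm x"
proof -
  have bA: "bounded_clinear A" using A compact_operator_def by blast
  define B where "B = {x \<in> V. norm x = 1}"
  define s where "s = (SUP x\<in>B. norm (A x))"
  obtain K where K: "\<And>x. norm (A x) \<le> K * norm x" using bounded_clinear_bound[OF bA] by blast
  have bdd: "bdd_above ((\<lambda>x. norm (A x)) ` B)"
    using K by (intro bdd_aboveI[of _ K]) (auto simp: B_def, metis mult.right_neutral)
  have "v \<in> B" using v by (simp add: B_def)
  have le_s: "norm (A x) \<le> s" if "x \<in> B" for x
    unfolding s_def by (rule cSUP_upper[OF that bdd])
  have scale: "norm (A x) \<le> s * norm x" if "x \<in> V" for x
  proof (cases "x = 0")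
    case True then show ?thesis by (simp add: bounded_clinear_zero[OF bA])
  next
    case False
    then have "complex_of_real (1 / norm x) *\<^sub>C x \<in> B"
      using that V(1) by (simp add: B_def complex_vector.subspace_scale norm_divide)
    from le_s[OF this] False show ?thesis
      by (simp add: bounded_clinear_scaleC[OF bA] norm_divide field_simps)
  qed
  have s0: "0 \<le> s" using le_s[OF \<open>v \<in> B\<close>] norm_ge_zero order_trans by blast
  have "\<exists>u\<in>B. s \<le> norm (A u)"
  \<comment> \<open>The estimate below controls \<open>y\<close> only after division by the square
    of \<open>s\<close>. If \<open>s = 0\<close>, every unit vector of \<open>V\<close> is a
    maximizer.\<close>
  proof (cases "s = 0")
    case True then show ?thesis using \<open>v \<in> B\<close> by auto
  next
    case False
    have "\<exists>x\<in>B. s - 1 / real (Suc k) < norm (A x)" for k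
    proof -
      have "s - 1 / real (Suc k) < s" by simp
      then show ?thesis unfolding s_def using less_cSUP_iff[OF _ bdd] \<open>v \<in> B\<close> by blast
    qed
    then obtain x where x: "\<And>k. x k \<in> B" "\<And>k. s - 1 / real (Suc k) < norm (A (x k))" by metis
    obtain l r where lr: "strict_mono r" "(\<lambda>k. A (x (r k))) \<longlonglongrightarrow> l"
      by (rule compact_operator_subsequence[OF A, of x 1]) (use x(1) in \<open>auto simp: B_def\<close>)
    define y where "y k = x (r k)" for k
    have yB: "y k \<in> B" for k by (simp add: y_def x)
    have Ay: "(\<lambda>k. A (y k)) \<longlonglongrightarrow> l" using lr(2) by (simp add: y_def)
    have nAy: "(\<lambda>k. norm (A (y k))) \<longlonglongrightarrow> s"
    proof (rule tendsto_sandwich)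
      have "(\<lambda>k. s - 1 / real (Suc k)) \<longlonglongrightarrow> s - 0"
        by (intro tendsto_intros LIMSEQ_Suc[OF lim_1_over_n])
      then show "(\<lambda>k. s - 1 / real (Suc (r k))) \<longlonglongrightarrow> s"
        using LIMSEQ_subseq_LIMSEQ[OF _ lr(1)] by (force simp: comp_def)
    qed (use x(2) in \<open>auto simp: y_def le_s x(1) less_imp_le simp del: of_nat_Suc\<close>)
    have parallelogram: "s\<^sup>2 * (norm (y k - y m))\<^sup>2 \<le>
        2 * (s\<^sup>2 - (norm (A (y k)))\<^sup>2) + 2 * (s\<^sup>2 - (norm (A (y m)))\<^sup>2) + (norm (A (y k) - A (y m)))\<^sup>2"
      for k m
    proof -
      have par: "(norm (a - b))\<^sup>2 + (norm (a + b))\<^sup>2 = 2 * (norm a)\<^sup>2 + 2 * (norm b)\<^sup>2"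
        for a b :: "'c::real_inner"
        by (simp add: power2_norm_eq_inner inner_diff_left inner_diff_right inner_add_left
            inner_add_right inner_commute)
      have "y k + y m \<in> V" using yB V(1) by (simp add: B_def complex_vector.subspace_add)
      from power_mono[OF scale[OF this], of 2]
      have "(norm (A (y k) + A (y m)))\<^sup>2 \<le> s\<^sup>2 * (norm (y k + y m))\<^sup>2"
        by (simp add: bounded_clinear_add[OF bA] power_mult_distrib)
      moreover have "s\<^sup>2 * (norm (y k + y m))\<^sup>2 = s\<^sup>2 * (4 - (norm (y k - y m))\<^sup>2)"
        using par[of "y k" "y m"] yB by (simp add: B_def)
      ultimately show ?thesis using par[of "A (y k)" "A (y m)"] by (simp add: algebra_simps)
    qed
    have "Cauchy y"
    proof (rule metric_CauchyI)
      fix e :: real assume "e > 0"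
      \<comment> \<open>The right-hand side of \<open>parallelogram\<close> will be below
        \<open>2 * d + 2 * d + d\<close>, hence below \<open>8 * d\<close>, the product of the
        squares of \<open>s\<close> and \<open>e\<close>.\<close>
      define d where "d = s\<^sup>2 * e\<^sup>2 / 8"
      have "d > 0" using \<open>e > 0\<close> False by (simp add: d_def)
      have "(\<lambda>k. (norm (A (y k)))\<^sup>2) \<longlonglongrightarrow> s\<^sup>2" by (intro tendsto_intros nAy)
      then obtain N1 where N1: "\<And>k. k \<ge> N1 \<Longrightarrow> \<bar>(norm (A (y k)))\<^sup>2 - s\<^sup>2\<bar> < d"
        using \<open>d > 0\<close> unfolding LIMSEQ_iff by (metis real_norm_def)
      obtain N2 where N2: "\<And>k m. k \<ge> N2 \<Longrightarrow> m \<ge> N2 \<Longrightarrow> norm (A (y k) - A (y m)) < sqrt d"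
        using LIMSEQ_imp_Cauchy[OF Ay] \<open>d > 0\<close> unfolding Cauchy_iff
        by (meson real_sqrt_gt_zero)
      have "dist (y k) (y m) < e" if "k \<ge> max N1 N2" "m \<ge> max N1 N2" for k m
      proof -
        have "(norm (A (y k) - A (y m)))\<^sup>2 < (sqrt d)\<^sup>2"
          using N2[of k m] that by (intro power_strict_mono) auto
        then have "s\<^sup>2 * (norm (y k - y m))\<^sup>2 < 8 * d"
          using parallelogram[of k m] N1[of k] N1[of m] that \<open>d > 0\<close> by simp
        then have "(norm (y k - y m))\<^sup>2 < e\<^sup>2" using False by (simp add: d_def)
        then show ?thesis using \<open>e > 0\<close> by (simp add: dist_norm power2_less_imp_less)
      qed
      then show "\<exists>M. \<forall>m\<ge>M. \<forall>n\<ge>M. dist (y m) (y n) < e" by blast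
    qed
    then obtain u where u: "y \<longlonglongrightarrow> u" using Cauchy_convergent convergent_def by blast
    have "u \<in> V" using closed_sequentially[OF V(2) _ u] yB by (simp add: B_def)
    moreover have "norm u = 1"
      using LIMSEQ_unique[OF tendsto_norm[OF u]] yB by (simp add: B_def)
    moreover have "norm (A u) = s"
      using LIMSEQ_unique[OF tendsto_norm[OF bounded_clinear_tendsto[OF bA u]] nAy] .
    ultimately show ?thesis by (auto simp: B_def)
  qed
  then obtain u where u: "u \<in> B" "s \<le> norm (A u)" by blast
  show ?thesis
  proof
    show "norm (A x) \<le> norm (A u) * norm x" if "x \<in> V" for x
      using scale[OF that] mult_right_mono[OF u(2), of "norm x"] by simp
  qed (use u in \<open>auto simp: B_def\<close>)
qed

text \<open>First variation: along \<open>u + t c x\<close> the quotient \<open>norm (A \<cdot>) / norm \<cdot>\<close> is maximal at \<open>t = 0\<close>.\<close>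

lemma norm_maximizer_orthogonal:
  assumes A: "bounded_clinear A" and V: "complex_vector.subspace V"
    and u: "u \<in> V" "norm u = 1" "\<And>x. x \<in> V \<Longrightarrow> norm (A x) \<le> norm (A u) * norm x"
    and x: "x \<in> V" "cinner x u = 0"
  shows "cinner (A x) (A u) = 0"
proof (rule ccontr)
  assume nz: "cinner (A x) (A u) \<noteq> 0"
  define c where "c = cinner (A x) (A u)"
  define D where "D = (norm (A u))\<^sup>2 * (norm x)\<^sup>2"
  have D: "0 \<le> D" by (simp add: D_def)
  \<comment> \<open>Along the variation the squared norm of the image gains at least
    \<open>2 * t\<close> times |\<open>c\<close>|^2, while maximality allows only
    \<open>t * (t * D)\<close> times |\<open>c\<close>|^2. With \<open>t * D < 1\<close> this is a
    contradiction; the summand 1 covers \<open>D = 0\<close>.\<close>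
  define t where "t = 1 / (D + 1)"
  have t: "t > 0" "t * D < 1" using D by (simp_all add: t_def field_simps)
  \<comment> \<open>The factor \<open>cnj c\<close> turns the cross term into \<open>t\<close> times
    |\<open>c\<close>|^2, which is real and positive.\<close>
  define w where "w = (complex_of_real t * cnj c) *\<^sub>C x"
  have "w \<in> V" using x V by (simp add: w_def complex_vector.subspace_scale)
  have uw: "(norm (u + w))\<^sup>2 = 1 + t\<^sup>2 * (cmod c)\<^sup>2 * (norm x)\<^sup>2"
    using norm_add_Pythagorean_complex[of u w] x(2) u(2)
    by (simp add: w_def cinner_scaleC_right cinner_eq_zero_commute[of u x] norm_mult power_mult_distrib)
  have "Re (cinner (A u) (A w)) = Re (cinner (A w) (A u))" by (metis cinner_commute cnj.simps(1))
  also have "cinner (A w) (A u) = complex_of_real t * (c * cnj c)"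
    by (simp add: w_def c_def bounded_clinear_scaleC[OF A] cinner_scaleC_left)
  also have "Re \<dots> = t * (cmod c)\<^sup>2" by (simp add: complex_mult_cnj cmod_power2)
  finally have Re: "Re (cinner (A u) (A w)) = t * (cmod c)\<^sup>2" .
  have "(norm (A u))\<^sup>2 + 2 * (t * (cmod c)\<^sup>2) \<le> (norm (A (u + w)))\<^sup>2"
    using norm_add_square[of "A u" "A w"] by (simp add: bounded_clinear_add[OF A] Re)
  also have "\<dots> \<le> (norm (A u) * norm (u + w))\<^sup>2"
    using u(1,3) \<open>w \<in> V\<close> V by (intro power_mono) (auto intro: complex_vector.subspace_add)
  also have "\<dots> = (norm (A u))\<^sup>2 + t\<^sup>2 * (cmod c)\<^sup>2 * D"
    by (simp add: power_mult_distrib uw D_def algebra_simps)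
  finally have "(t * (cmod c)\<^sup>2) * 2 \<le> (t * (cmod c)\<^sup>2) * (t * D)"
    by (simp add: power2_eq_square mult_ac)
  then show False using t nz by (simp add: c_def)
qed

text \<open>If the limit \<open>L\<close> were positive, the images \<open>A (e n)\<close> would be
  pairwise orthogonal of norm at least \<open>L\<close>, hence at mutual distance at least
  \<open>L\<close>, and no subsequence of them could be Cauchy.\<close>

lemma compact_operator_orthonormal_limit:
  fixes A :: "'a::complex_inner \<Rightarrow> 'b::complex_inner"
  assumes A: "compact_operator A" and e: "\<And>n. norm (e n) = 1" and f: "orthonormal_on UNIV f"
    and a: "\<And>n. A (e n) = complex_of_real (a n) *\<^sub>C f n" "decseq a" "\<And>n. 0 \<le> a n"
  shows "a \<longlonglongrightarrow> 0"
proof -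
  obtain L where L: "a \<longlonglongrightarrow> L" "\<And>n. L \<le> a n"
    by (rule decseq_convergent[OF a(2), of 0]) (use a(3) in auto)
  have "L \<ge> 0" by (rule LIMSEQ_le_const[OF L(1)]) (use a(3) in auto)
  obtain l r where lr: "strict_mono r" "(\<lambda>k. A (e (r k))) \<longlonglongrightarrow> l"
    by (rule compact_operator_subsequence[OF A, of e 1]) (use e in auto)
  have "L = 0"
  proof (rule ccontr)
    assume "L \<noteq> 0"
    then have "L > 0" using \<open>L \<ge> 0\<close> by simp
    then obtain N where N: "\<And>k m. k \<ge> N \<Longrightarrow> m \<ge> N \<Longrightarrow> norm (A (e (r k)) - A (e (r m))) < L"
      using LIMSEQ_imp_Cauchy[OF lr(2), unfolded Cauchy_iff] by blast
    let ?k = "r N" and ?m = "r (Suc N)"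
    have "?k \<noteq> ?m" using strict_monoD[OF lr(1), of N "Suc N"] by simp
    then have "(norm (A (e ?k) + - A (e ?m)))\<^sup>2 = (norm (A (e ?k)))\<^sup>2 + (norm (- A (e ?m)))\<^sup>2"
      by (intro norm_add_Pythagorean_complex)
        (simp add: a(1) cinner.minus_right cinner_scaleC_left cinner_scaleC_right orthonormal_onD[OF f])
    moreover have "L\<^sup>2 \<le> (norm (A (e n)))\<^sup>2" for n
      using power_mono[OF L(2) \<open>L \<ge> 0\<close>, of 2] orthonormal_on_norm[OF f, of n] by (simp add: a(1))
    ultimately have "L\<^sup>2 \<le> (norm (A (e ?k) + - A (e ?m)))\<^sup>2"
      by (metis add_increasing2 zero_le_power2)
    then have "L \<le> norm (A (e ?k) + - A (e ?m))" by (rule power2_le_imp_le) simp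
    then show False using N[of N "Suc N"] by simp
  qed
  then show ?thesis using L(1) by simp
qed

text \<open>Greedy choice: each \<open>e n\<close> maximizes the norm of the image on the orthogonal
  complement of its predecessors. Maximality makes the images orthogonal. A vector orthogonal to all
  \<open>e n\<close> satisfies \<open>norm (A x) \<le> a n * norm x\<close> for every
  \<open>n\<close>, so it lies in the kernel because \<open>a\<close> tends to 0.\<close>

theorem singular_value_decomposition:
  fixes A :: "'a::chilbert_space \<Rightarrow> 'b::chilbert_space"
  assumes inf_a: "\<not> cfinite_dim (UNIV :: 'a set)" and inf_b: "\<not> cfinite_dim (UNIV :: 'b set)"
    and A: "compact_operator A"
  obtains a e f where "decseq a" "\<And>n. 0 \<le> a n" "a \<longlonglongrightarrow> 0" "orthonormal_on UNIV e"
    "orthonormal_on UNIV f" "A = diag_op a e f"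
proof -
  have bA: "bounded_clinear A" using A compact_operator_def by blast
  define V :: "(nat \<Rightarrow> 'a) \<Rightarrow> nat \<Rightarrow> 'a set" where "V e n = {x. \<forall>i<n. cinner x (e i) = 0}" for e n
  have V: "complex_vector.subspace (V e n)" for e n
    unfolding complex_vector.subspace_def V_def by (simp add: cinner_add_left cinner_scaleC_left)
  have closed_V: "closed (V e n)" for e n
  proof -
    have "closed {x. cinner x (e i) = 0}" for i
    proof (rule closed_Collect_eq)
      show "continuous_on UNIV (\<lambda>x. cinner x (e i))"
        by (rule linear_continuous_on[OF cinner.bounded_linear_left])
    qed simp
    moreover have "V e n = (\<Inter>i<n. {x. cinner x (e i) = 0})" by (auto simp: V_def)
    ultimately show ?thesis by auto
  qed
  \<comment> \<open>Well-founded choice along \<open><\<close>: the condition on the value at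
    \<open>n\<close> refers to \<open>e\<close> only through \<open>V e n\<close>, that is, through
    earlier values.\<close>
  have "\<exists>e. \<forall>n. e n \<in> V e n \<and> norm (e n) = 1 \<and> (\<forall>x\<in>V e n. norm (A x) \<le> norm (A (e n)) * norm x)"
  proof (rule dependent_wf_choice[OF wf_less_than])
    fix n and e :: "nat \<Rightarrow> 'a"
    assume e: "\<And>m. (m, n) \<in> less_than \<Longrightarrow>
      e m \<in> V e m \<and> norm (e m) = 1 \<and> (\<forall>x\<in>V e m. norm (A x) \<le> norm (A (e m)) * norm x)"
    have lt: "cinner (e i) (e j) = 0" if "i < n" "j < i" for i j
      using e[of i] that by (simp add: V_def)
    have "orthonormal_on {..<n} e"
      unfolding orthonormal_on_def
    proof (intro ballI)
      fix i j assume "i \<in> {..<n}" "j \<in> {..<n}"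
      then show "cinner (e i) (e j) = (if i = j then 1 else 0)"
        using lt[of i j] lt[of j i] e[of i] cinner_eq_zero_commute[of "e i" "e j"]
        by (cases i j rule: linorder_cases) (auto simp: cinner_self)
    qed
    then obtain v where v: "norm v = 1" "v \<in> V e n"
      using exists_unit_orthogonal[OF inf_a] by (auto simp: V_def)
    show "\<exists>u. u \<in> V e n \<and> norm u = 1 \<and> (\<forall>x\<in>V e n. norm (A x) \<le> norm (A u) * norm x)"
      by (rule compact_operator_attains_norm[OF A V closed_V v(2,1)]) blast
  next
    fix e g :: "nat \<Rightarrow> 'a" and n r assume "\<And>m. (m, n) \<in> less_than \<Longrightarrow> e m = g m"
    then have "V e n = V g n" by (simp add: V_def)
    then show "(r \<in> V e n \<and> norm r = 1 \<and> (\<forall>x\<in>V e n. norm (A x) \<le> norm (A r) * norm x))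
      = (r \<in> V g n \<and> norm r = 1 \<and> (\<forall>x\<in>V g n. norm (A x) \<le> norm (A r) * norm x))" by simp
  qed
  then obtain e where eV: "\<And>n. e n \<in> V e n" and ne: "\<And>n. norm (e n) = 1"
    and max: "\<And>n x. x \<in> V e n \<Longrightarrow> norm (A x) \<le> norm (A (e n)) * norm x" by blast
  have mono_V: "V e n \<subseteq> V e m" if "m \<le> n" for m n using that by (auto simp: V_def)
  have ortho_e: "cinner (e j) (e i) = 0" if "i < j" for i j
    using eV[of j] that by (simp add: V_def)
  have e: "orthonormal_on UNIV e"
    unfolding orthonormal_on_def
  proof (intro ballI)
    fix i j show "cinner (e i) (e j) = (if i = j then 1 else 0)"
      using ortho_e[of i j] ortho_e[of j i] ne cinner_eq_zero_commute[of "e i" "e j"]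
      by (cases i j rule: linorder_cases) (auto simp: cinner_self)
  qed
  have ortho_A: "cinner (A (e j)) (A (e i)) = 0" if "i < j" for i j
    by (rule norm_maximizer_orthogonal[OF bA V eV[of i] ne max])
      (use that eV[of j] mono_V[of i j] ortho_e in auto)
  define a where "a n = norm (A (e n))" for n
  have a0: "0 \<le> a n" for n by (simp add: a_def)
  have dec: "decseq a"
    unfolding decseq_def a_def
  proof (intro allI impI)
    fix m n :: nat assume "m \<le> n"
    then show "norm (A (e n)) \<le> norm (A (e m))"
      using max[OF subsetD[OF mono_V eV], of m n] ne by simp
  qed
  \<comment> \<open>For \<open>a n = 0\<close> the last conjunct puts no constraint on
    \<open>r\<close>; a fresh vector orthogonal to the earlier ones has to be supplied, so this
    choice is recursive too.\<close>
  define P where "P f n r \<longleftrightarrow> norm r = 1 \<and> (\<forall>i<n. cinner r (f i) = 0) \<and>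
      A (e n) = complex_of_real (a n) *\<^sub>C r" for f :: "nat \<Rightarrow> 'b" and n r
  have "\<exists>f. \<forall>n. P f n (f n)"
  proof (rule dependent_wf_choice[OF wf_less_than])
    fix n and f :: "nat \<Rightarrow> 'b"
    assume f: "\<And>m. (m, n) \<in> less_than \<Longrightarrow> P f m (f m)"
    have lt: "cinner (f i) (f j) = 0" if "i < n" "j < i" for i j
      using f[of i] that by (simp add: P_def)
    have "orthonormal_on {..<n} f"
      unfolding orthonormal_on_def
    proof (intro ballI)
      fix i j assume "i \<in> {..<n}" "j \<in> {..<n}"
      then show "cinner (f i) (f j) = (if i = j then 1 else 0)"
        using lt[of i j] lt[of j i] f[of i] cinner_eq_zero_commute[of "f i" "f j"]
        by (cases i j rule: linorder_cases) (auto simp: cinner_self P_def)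
    qed
    then obtain v where v: "norm v = 1" "\<And>i. i < n \<Longrightarrow> cinner v (f i) = 0"
      using exists_unit_orthogonal[OF inf_b] by blast
    show "\<exists>r. P f n r"
    proof (cases "a n = 0")
      case True
      then have "P f n v" using v by (simp add: P_def a_def)
      then show ?thesis ..
    next
      case False
      define r where "r = complex_of_real (1 / a n) *\<^sub>C A (e n)"
      have "cinner r (f i) = 0" if "i < n" for i
      proof -
        \<comment> \<open>A positive \<open>a n\<close> has only positive predecessors, so every
          earlier \<open>f i\<close> is a normalised image rather than a filler, and
          \<open>ortho_A\<close> applies.\<close>
        have "a i > 0" using decseqD[OF dec, of i n] that False a0[of n] by linarith
        then have "f i = complex_of_real (1 / a i) *\<^sub>C A (e i)"
          using f[of i] that by (simp add: P_def scaleC_scaleC scaleC_one)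
        then show ?thesis by (simp add: r_def cinner_scaleC_left cinner_scaleC_right ortho_A that)
      qed
      moreover have "norm r = 1" using False by (simp add: r_def norm_divide) (simp add: a_def)
      ultimately have "P f n r" using False by (simp add: P_def r_def scaleC_scaleC scaleC_one)
      then show ?thesis ..
    qed
  qed (auto simp: P_def)
  then obtain f where nf: "\<And>n. norm (f n) = 1" and ortho_f: "\<And>n i. i < n \<Longrightarrow> cinner (f n) (f i) = 0"
    and Ae: "\<And>n. A (e n) = complex_of_real (a n) *\<^sub>C f n" by (auto simp: P_def)
  have f: "orthonormal_on UNIV f"
    unfolding orthonormal_on_def
  proof (intro ballI)
    fix i j show "cinner (f i) (f j) = (if i = j then 1 else 0)"
      using ortho_f[of i j] ortho_f[of j i] nf cinner_eq_zero_commute[of "f i" "f j"]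
      by (cases i j rule: linorder_cases) (auto simp: cinner_self)
  qed
  have lim: "a \<longlonglongrightarrow> 0" by (rule compact_operator_orthonormal_limit[OF A ne f Ae dec a0])
  have bound: "\<bar>a n\<bar> \<le> a 0" for n using a0 decseqD[OF dec] by simp
  have "A = diag_op a e f"
  proof (rule bounded_clinear_eqI_orthonormal[OF bA bounded_clinear_diag_op[OF e f bound] e])
    show "A (e n) = diag_op a e f (e n)" for n by (simp add: diag_op_basis[OF e f] Ae)
    fix x assume x: "\<And>n. cinner x (e n) = 0"
    have "norm (A x) \<le> a n * norm x" for n using max[of x n] x by (simp add: V_def a_def)
    then have "norm (A x) \<le> 0"
      using LIMSEQ_le_const[OF tendsto_mult_left_zero[OF lim, of "norm x"]] by blast
    then show "A x = diag_op a e f x" using diag_op_eq_zero[OF e f x] by simp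
  qed
  then show ?thesis using that dec a0 lim e f by blast
qed


section \<open>Singular values of diagonal operators\<close>

lemma cadjoint_eqI:
  assumes "\<And>x y. cinner (T x) y = cinner x (S y)" shows "cadjoint T = S"
  unfolding cadjoint_def
proof (rule the_equality)
  fix S' assume "\<forall>x y. cinner (T x) y = cinner x (S' y)"
  then show "S' = S" using assms by (intro ext eq_if_cinner_right_eq) simp
qed (use assms in blast)

text \<open>Polarization: realness of the quadratic form at \<open>x + y\<close> relates the
  imaginary parts, and replacing \<open>y\<close> by \<open>\<i> *\<^sub>C y\<close> turns this into
  the statement about real parts.\<close>

lemma positive_operator_selfadjoint:
  assumes P: "positive_operator P" shows "cinner (P x) y = cinner x (P y)"
proof -
  have bP: "bounded_clinear P" and q: "Im (cinner (P z) z) = 0" for z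
    using P complex_is_Real_iff nonneg_Reals_subset_Reals unfolding positive_operator_def by auto
  have Im: "Im (cinner (P x) y) + Im (cinner (P y) x) = 0" for x y
    using q[of "x + y"] q[of x] q[of y]
    by (simp add: bounded_clinear_add[OF bP] cinner_add_left cinner_add_right)
  have "Re (cinner (P x) y) = Re (cinner (P y) x)"
    using Im[of x "\<i> *\<^sub>C y"]
    by (simp add: bounded_clinear_scaleC[OF bP] cinner_scaleC_left cinner_scaleC_right)
  then have "cinner (P x) y = cnj (cinner (P y) x)"
    using Im[of x y] by (simp add: complex_eq_iff)
  then show ?thesis using cinner_commute[of x "P y"] by simp
qed

text \<open>If \<open>v = P x - r x\<close> then \<open>(P + r) v = 0\<close>, which is impossible for \<open>r > 0\<close> unless \<open>v = 0\<close>.\<close>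

lemma positive_operator_square_eigenvector:
  assumes P: "positive_operator P" and r: "0 \<le> r"
    and x: "P (P x) = complex_of_real (r\<^sup>2) *\<^sub>C x"
  shows "P x = complex_of_real r *\<^sub>C x"
proof (cases "r = 0")
  case True
  then have "cinner (P x) (P x) = 0"
    using x positive_operator_selfadjoint[OF P, of "P x" x, symmetric] by simp
  then show ?thesis using True by simp
next
  case False
  have bP: "bounded_clinear P" using P positive_operator_def by blast
  define v where "v = P x - complex_of_real r *\<^sub>C x"
  have "P v = - complex_of_real r *\<^sub>C v"
    using x by (simp add: v_def bounded_clinear_diff[OF bP] bounded_clinear_scaleC[OF bP]
        scaleC.diff_right scaleC.minus_left scaleC_scaleC power2_eq_square)
  then have "cinner (P v) v = complex_of_real (- r * (norm v)\<^sup>2)"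
    by (simp add: cinner_scaleC_left cinner_self cinner.minus_left scaleC.minus_left)
  moreover have "cinner (P v) v \<in> \<real>\<^sub>\<ge>\<^sub>0" using P positive_operator_def by blast
  ultimately have "0 \<le> - r * (norm v)\<^sup>2" by (simp only: nonneg_Reals_of_real_iff)
  then have "v = 0" using r False by (simp add: mult_le_0_iff)
  then show ?thesis by (simp add: v_def)
qed

context
  fixes a :: "nat \<Rightarrow> real" and e :: "nat \<Rightarrow> 'a::chilbert_space" and K :: real
  assumes e: "orthonormal_on UNIV e" and a0: "\<And>n. 0 \<le> a n" and aK: "\<And>n. a n \<le> K"
begin

lemma positive_operator_diag_op: "positive_operator (diag_op a e e)"
  unfolding positive_operator_def
proof (intro conjI allI)
  have bound: "\<bar>a n\<bar> \<le> K" for n using a0 aK by simp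
  show "bounded_clinear (diag_op a e e)" by (rule bounded_clinear_diag_op[OF e e bound])
  fix x
  have sums: "(\<lambda>n. complex_of_real (a n * (cmod (cinner x (e n)))\<^sup>2)) sums cinner (diag_op a e e x) x"
  proof -
    have "cinner x (e n) * cinner (e n) x = complex_of_real ((cmod (cinner x (e n)))\<^sup>2)" for n
      unfolding complex_norm_square cinner_commute[of "e n" x] ..
    then show ?thesis
      using cinner_diag_op_sums[where c = a and x = x and y = x, OF e e bound] by (simp add: mult.assoc)
  qed
  then have "(\<lambda>n. a n * (cmod (cinner x (e n)))\<^sup>2) sums Re (cinner (diag_op a e e x) x)"
    and "(\<lambda>n. 0) sums Im (cinner (diag_op a e e x) x)"
    by (auto simp: sums_complex_iff simp del: of_real_mult of_real_power)
  then have "0 \<le> Re (cinner (diag_op a e e x) x)" "Im (cinner (diag_op a e e x) x) = 0"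
    using sums_le[OF _ sums_zero, of "\<lambda>n. a n * (cmod (cinner x (e n)))\<^sup>2"]
      sums_unique2[OF sums_zero] a0 by auto
  then show "cinner (diag_op a e e x) x \<in> \<real>\<^sub>\<ge>\<^sub>0" by (simp add: complex_nonneg_Reals_iff)
qed

text \<open>\<open>THE\<close> demands uniqueness. Any positive root \<open>P\<close> has each
  \<open>e n\<close> as an eigenvector for \<open>a n\<close>, and it kills the vectors orthogonal
  to all \<open>e n\<close>, which are eigenvectors of the square for 0; so \<open>P\<close> is
  determined.\<close>

lemma sqrt_operator_diag_op: "sqrt_operator (diag_op (\<lambda>n. (a n)\<^sup>2) e e) = diag_op a e e"
proof -
  have bound: "\<bar>a n\<bar> \<le> K" for n using a0 aK by simp
  show ?thesis
    unfolding sqrt_operator_def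
  proof (rule the_equality)
    show "positive_operator (diag_op a e e) \<and> diag_op a e e \<circ> diag_op a e e = diag_op (\<lambda>n. (a n)\<^sup>2) e e"
      by (auto simp: positive_operator_diag_op diag_op_comp[OF e e bound] power2_eq_square)
    fix P assume P: "positive_operator P \<and> P \<circ> P = diag_op (\<lambda>n. (a n)\<^sup>2) e e"
    then have PP: "P (P x) = diag_op (\<lambda>n. (a n)\<^sup>2) e e x" for x by (metis comp_apply)
    show "P = diag_op a e e"
    proof (rule bounded_clinear_eqI_orthonormal[OF _ bounded_clinear_diag_op[OF e e bound] e])
      show "bounded_clinear P" using P positive_operator_def by blast
      show "P (e n) = diag_op a e e (e n)" for n
        using positive_operator_square_eigenvector[of P "a n" "e n"] P
        by (simp add: PP diag_op_basis[OF e e] a0)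
      show "P x = diag_op a e e x" if "\<And>n. cinner x (e n) = 0" for x
        using positive_operator_square_eigenvector[of P 0 x] P
        by (simp add: PP diag_op_eq_zero[OF e e that])
    qed
  qed
qed

text \<open>Comparing coefficients leaves only the indices with \<open>a n = r\<close>. Since
  \<open>r > 0\<close>, \<open>x\<close> is \<open>1 / r\<close> times its image, a finite sum over
  these indices; at \<open>r = 0\<close> any vectors orthogonal to all \<open>e n\<close> would
  enter as well.\<close>

lemma eigenspace_diag_op:
  assumes r: "r > 0" and fin: "finite {n. a n = r}"
  shows "eigenspace (diag_op a e e) (complex_of_real r) = complex_vector.span (e ` {n. a n = r})"
proof
  have bound: "\<bar>a n\<bar> \<le> K" for n using a0 aK by simp
  note D = bounded_clinear_diag_op[OF e e bound]
  let ?S = "{n. a n = r}"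
  show "eigenspace (diag_op a e e) (complex_of_real r) \<subseteq> complex_vector.span (e ` ?S)"
  proof
    fix x assume "x \<in> eigenspace (diag_op a e e) (complex_of_real r)"
    then have x: "diag_op a e e x = complex_of_real r *\<^sub>C x" by (simp add: eigenspace_def)
    have zero: "cinner x (e n) = 0" if "n \<notin> ?S" for n
      using cinner_diag_op[where c = a and x = x and n = n, OF e e bound] that by (simp add: x cinner_scaleC_left)
    have "complex_of_real r *\<^sub>C x = (\<Sum>n\<in>?S. (complex_of_real (a n) * cinner x (e n)) *\<^sub>C e n)"
      unfolding x[symmetric] diag_op_def by (rule suminf_finite[OF fin]) (simp add: zero)
    also have "\<dots> \<in> complex_vector.span (e ` ?S)"
      by (intro complex_vector.span_sum complex_vector.span_scale complex_vector.span_base) auto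
    finally have "complex_of_real (1 / r) *\<^sub>C complex_of_real r *\<^sub>C x \<in> complex_vector.span (e ` ?S)"
      by (rule complex_vector.span_scale)
    then show "x \<in> complex_vector.span (e ` ?S)" using r by (simp add: scaleC_scaleC scaleC_one)
  qed
  show "complex_vector.span (e ` ?S) \<subseteq> eigenspace (diag_op a e e) (complex_of_real r)"
  proof (rule complex_vector.span_minimal)
    show "complex_vector.subspace (eigenspace (diag_op a e e) (complex_of_real r))"
      unfolding complex_vector.subspace_def eigenspace_def
      by (simp add: bounded_clinear_add[OF D] bounded_clinear_zero[OF D] bounded_clinear_scaleC[OF D]
          scaleC_add_right scaleC_scaleC mult.commute)
  qed (auto simp: eigenspace_def diag_op_basis[OF e e])
qed

end

text \<open>Let \<open>n\<close> be the first difference, with \<open>s n < t n = r\<close>. As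
  \<open>s\<close> decreases, it takes the value \<open>r\<close> only before \<open>n\<close>,
  where both sequences agree; \<open>t\<close> takes it once more at \<open>n\<close>, contradicting
  equal multiplicities.\<close>

lemma eigenvalue_sequence_unique:
  assumes s: "eigenvalue_sequence P s" and t: "eigenvalue_sequence P t"
  shows "s = t"
proof (rule ccontr)
  have not_less: "\<not> s n < t n"
    if s: "eigenvalue_sequence P s" and t: "eigenvalue_sequence P t" and eq: "\<And>k. k < n \<Longrightarrow> s k = t k"
    for s t n
  proof
    assume less: "s n < t n"
    have "decseq s" "0 \<le> s n" using s by (auto simp: eigenvalue_sequence_def)
    define r where "r = t n"
    have "r > 0" using less \<open>0 \<le> s n\<close> by (simp add: r_def)
    then have card: "card {k. s k = r} = card {k. t k = r}" and fin: "finite {k. t k = r}"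
      using s t by (auto simp: eigenvalue_sequence_def)
    have "{k. s k = r} \<subseteq> {k. t k = r} - {n}"
    proof
      fix k assume "k \<in> {k. s k = r}"
      then have k: "s k = r" by simp
      have "k < n"
        using decseqD[OF \<open>decseq s\<close>, of n k] k less by (cases "k < n") (simp_all add: r_def)
      then show "k \<in> {k. t k = r} - {n}" using eq[of k] k by simp
    qed
    then have "card {k. s k = r} \<le> card ({k. t k = r} - {n})" using fin by (intro card_mono) auto
    also have "\<dots> < card {k. t k = r}" by (rule card_Diff1_less[OF fin]) (simp add: r_def)
    finally show False using card by simp
  qed
  assume "s \<noteq> t"
  then have ex: "\<exists>n. s n \<noteq> t n" by auto
  define n where "n = (LEAST n. s n \<noteq> t n)"
  have "s n \<noteq> t n" unfolding n_def by (rule LeastI_ex[OF ex])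
  moreover have eq: "s k = t k" if "k < n" for k using not_less_Least[of k "\<lambda>n. s n \<noteq> t n"] that unfolding n_def by simp
  ultimately show False
    using not_less[OF s t, of n, OF eq] not_less[OF t s, of n, OF eq[symmetric]] by simp
qed

text \<open>The bridge from \<open>s_number\<close>, with its three nested definite descriptions
  (adjoint, root, sequence), to the coefficients of a decomposition. Convergence to 0 makes the
  level sets of \<open>a\<close> at positive values finite.\<close>

theorem s_number_diag_op:
  fixes e f :: "nat \<Rightarrow> 'a::chilbert_space"
  assumes a: "decseq a" "\<And>n. 0 \<le> a n" "a \<longlonglongrightarrow> 0"
    and e: "orthonormal_on UNIV e" and f: "orthonormal_on UNIV f"
  shows "s_number (diag_op a e f) = a"
proof -
  have aK: "a n \<le> a 0" for n using decseqD[OF a(1)] by simp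
  have bound: "\<bar>a n\<bar> \<le> a 0" for n using a(2) aK by simp
  have "cadjoint (diag_op a e f) = diag_op a f e"
    by (rule cadjoint_eqI) (rule cinner_diag_op_swap[OF e f bound])
  then have "cadjoint (diag_op a e f) \<circ> diag_op a e f = diag_op (\<lambda>n. (a n)\<^sup>2) e e"
    by (auto simp: diag_op_comp[OF e f bound] power2_eq_square)
  then have sqrt: "sqrt_operator (cadjoint (diag_op a e f) \<circ> diag_op a e f) = diag_op a e e"
    using sqrt_operator_diag_op[OF e a(2) aK] by simp
  have "eigenvalue_sequence (diag_op a e e) a"
    unfolding eigenvalue_sequence_def
  proof (intro conjI allI impI a)
    fix r :: real assume r: "r > 0"
    then obtain N where N: "\<And>n. n \<ge> N \<Longrightarrow> a n < r"
      using order_tendstoD(2)[OF a(3)] unfolding eventually_sequentially by blast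
    have "{n. a n = r} \<subseteq> {..<N}" using N by (force simp: not_less[symmetric])
    then show fin: "finite {n. a n = r}" using finite_subset by blast
    show "card {n. a n = r} = complex_vector.dim (eigenspace (diag_op a e e) (complex_of_real r))"
      unfolding eigenspace_diag_op[OF e a(2) aK r fin]
      using orthonormal_on_subset[OF e subset_UNIV, of "{n. a n = r}"]
      by (simp add: complex_vector.dim_eq_card_independent[OF orthonormal_on_independent]
          card_image orthonormal_on_inj)
  qed
  then show ?thesis
    unfolding s_number_def sqrt
    by (intro the_equality) (auto dest: eigenvalue_sequence_unique)
qed


section \<open>Comparison of singular values\<close>

text \<open>Zero entries of \<open>a\<close> are allowed, so operators of finite rank are covered.
  Where they occur, \<open>e n\<close> and \<open>f n\<close> carry no information about the
  operator.\<close>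

definition singular_system ::
  "(nat \<Rightarrow> real) \<Rightarrow> (nat \<Rightarrow> 'a::chilbert_space) \<Rightarrow> (nat \<Rightarrow> 'b::chilbert_space) \<Rightarrow> bool" where
  "singular_system a e f \<longleftrightarrow>
     decseq a \<and> (\<forall>n. 0 \<le> a n) \<and> a \<longlonglongrightarrow> 0 \<and> orthonormal_on UNIV e \<and> orthonormal_on UNIV f"

lemma singular_systemD:
  assumes "singular_system a e f"
  shows "decseq a" "0 \<le> a n" "a \<longlonglongrightarrow> 0" "orthonormal_on UNIV e" "orthonormal_on UNIV f"
    and "\<bar>a n\<bar> \<le> a 0" "m \<le> n \<Longrightarrow> a n \<le> a m" "bounded_clinear (diag_op a e f)"
proof -
  show a: "decseq a" "0 \<le> a n" "a \<longlonglongrightarrow> 0" and on: "orthonormal_on UNIV e" "orthonormal_on UNIV f" for n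
    using assms by (auto simp: singular_system_def)
  show "m \<le> n \<Longrightarrow> a n \<le> a m" for m n by (rule decseqD[OF a(1)])
  then show bound: "\<bar>a n\<bar> \<le> a 0" for n using a(2) by simp
  show "bounded_clinear (diag_op a e f)" by (rule bounded_clinear_diag_op[OF on bound])
qed

lemma compact_operator_singular_system:
  fixes A :: "'a::chilbert_space \<Rightarrow> 'a"
  assumes "\<not> cfinite_dim (UNIV :: 'a set)" "compact_operator A"
  obtains a e f where "singular_system a e f" "A = diag_op a e f" "s_number A = a"
proof -
  obtain a e f where *: "decseq a" "\<And>n. 0 \<le> a n" "a \<longlonglongrightarrow> 0" "orthonormal_on UNIV e"
    "orthonormal_on UNIV f" "A = diag_op a e f"
    by (rule singular_value_decomposition[OF assms(1,1,2)]) blast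
  have "singular_system a e f" unfolding singular_system_def using * by blast
  moreover have "s_number A = a" unfolding *(6) by (rule s_number_diag_op[OF *(1-5)])
  ultimately show ?thesis using that *(6) by blast
qed

lemma norm_diag_op_le_singular_value:
  assumes "singular_system a e f" and "\<And>i. i < n \<Longrightarrow> cinner x (e i) = 0"
  shows "norm (diag_op a e f x) \<le> a n * norm x"
proof (rule norm_diag_op_le[OF singular_systemD(4,5)[OF assms(1)]])
  fix m assume "cinner x (e m) \<noteq> 0"
  then have "n \<le> m" using assms(2) by (meson not_less)
  then show "\<bar>a m\<bar> \<le> a n" using singular_systemD(2,7)[OF assms(1)] by simp
qed (rule singular_systemD(2)[OF assms(1)])

lemma singular_value_le_on_span:
  assumes "singular_system a e f" "x \<in> complex_vector.span (e ` {..n})"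
  shows "a n * norm x \<le> norm (diag_op a e f x)"
  using span_diag_op_lower_bound[OF singular_systemD(4,5,6,1,2)[OF assms(1)] assms(2)] .

lemma diag_op_factor:
  assumes A: "singular_system a e f" and B: "singular_system b g h" and C: "\<And>n. b n \<le> C * a n"
  obtains X Y where "bounded_clinear X" "bounded_clinear Y"
    "\<And>x. X (diag_op a e f (Y x)) = diag_op b g h x"
proof -
  note A = singular_systemD[OF A] and B = singular_systemD[OF B]
  \<comment> \<open>Where \<open>a n = 0\<close>, the quotient \<open>b n / a n\<close> is 0 by
    convention; since \<open>b n\<close> vanishes there as well, \<open>a n * (b n / a n)\<close> is
    still \<open>b n\<close>.\<close>
  have b0: "b n = 0" if "a n = 0" for n using C[of n] B(2)[of n] that by simp
  have quot: "\<bar>b n / a n\<bar> \<le> \<bar>C\<bar>" for n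
  proof (cases "a n = 0")
    case False
    then have "a n > 0" using A(2)[of n] by simp
    then have "b n / a n \<le> C" using C[of n] by (simp add: divide_le_eq)
    then show ?thesis using A(2)[of n] B(2)[of n] by simp
  qed simp
  have one: "\<bar>1 :: real\<bar> \<le> 1" by simp
  show ?thesis
  proof
    show "bounded_clinear (diag_op (\<lambda>n. b n / a n) g e)" by (rule bounded_clinear_diag_op[OF B(4) A(4) quot])
    show "bounded_clinear (diag_op (\<lambda>_. 1) f h)" by (rule bounded_clinear_diag_op[OF A(5) B(5) one])
    show "diag_op (\<lambda>_. 1) f h (diag_op a e f (diag_op (\<lambda>n. b n / a n) g e x)) = diag_op b g h x" for x
    proof -
      have "(\<lambda>n. a n * (b n / a n)) = b" using b0 by force
      then have "diag_op a e f (diag_op (\<lambda>n. b n / a n) g e x) = diag_op b g f x"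
        using diag_op_comp[where c = "\<lambda>n. b n / a n" and d = a, OF B(4) A(4) quot] by simp
      then show ?thesis
        using diag_op_comp[where c = b and d = "\<lambda>_. 1", OF B(4) A(5) B(6)] by simp
    qed
  qed
qed

lemma singular_values_of_product:
  assumes A: "singular_system a e f" and B: "singular_system b g h"
    and X: "bounded_clinear X" and Y: "bounded_clinear Y"
    and eq: "\<And>x. X (diag_op a e f (Y x)) = diag_op b g h x"
  shows "\<exists>C. \<forall>n. b n \<le> C * a n"
proof -
  obtain K where K: "0 < K" "\<And>x. norm (X x) \<le> K * norm x" using bounded_clinear_bound[OF X] by blast
  obtain L where L: "0 < L" "\<And>x. norm (Y x) \<le> L * norm x" using bounded_clinear_bound[OF Y] by blast
  have "b n \<le> (K * L) * a n" for n
  proof -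
    obtain x where x: "x \<in> complex_vector.span (g ` {..n})" "x \<noteq> 0"
      "\<And>i. i < n \<Longrightarrow> cinner (Y x) (e i) = 0"
      using exists_orthogonal_in_span[OF orthonormal_on_subset[OF singular_systemD(4)[OF B] subset_UNIV] Y]
      by blast
    have "b n * norm x \<le> norm (X (diag_op a e f (Y x)))"
      unfolding eq by (rule singular_value_le_on_span[OF B x(1)])
    also have "\<dots> \<le> K * norm (diag_op a e f (Y x))" by (rule K(2))
    also have "\<dots> \<le> K * (a n * norm (Y x))"
      using norm_diag_op_le_singular_value[OF A x(3)] K(1) by (intro mult_left_mono) auto
    also have "\<dots> \<le> K * (a n * (L * norm x))"
      using L K(1) singular_systemD(2)[OF A] by (intro mult_left_mono) auto
    finally show ?thesis using x(2) by (simp add: mult_ac)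
  qed
  then show ?thesis by blast
qed

text \<open>In the span of \<open>n + k + 1\<close> vectors \<open>e i\<close> there is room for
  \<open>n + k\<close> orthogonality conditions: \<open>n\<close> against \<open>e'\<close>, which
  bound the new operator by \<open>a' n\<close>, and \<open>k\<close> against \<open>v\<close>,
  which make both operators agree at \<open>x\<close>.\<close>

lemma singular_values_of_restriction:
  assumes A: "singular_system a e f" and A': "singular_system a' e' f'"
    and v: "orthonormal_on {..<k} v"
    and eq: "\<And>x. diag_op a' e' f' x = diag_op a e f (x - proj_on {..<k} v x)"
  shows "a (n + k) \<le> a' n"
proof -
  obtain x where x: "x \<in> complex_vector.span (e ` {..n + k})" "x \<noteq> 0"
    "\<And>i. i < n + k \<Longrightarrow> cinner x (if i < n then e' i else v (i - n)) = 0"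
    by (rule exists_orthogonal_in_span[where n = "n + k" and w = "\<lambda>i. if i < n then e' i else v (i - n)",
          OF orthonormal_on_subset[OF singular_systemD(4)[OF A] subset_UNIV] bounded_clinear_id]) blast
  have "cinner x (v i) = 0" if "i < k" for i using x(3)[of "n + i"] that by simp
  then have px: "proj_on {..<k} v x = 0" by (intro proj_on_eq_zero) simp
  have "a (n + k) * norm x \<le> norm (diag_op a e f x)" by (rule singular_value_le_on_span[OF A x(1)])
  also have "\<dots> = norm (diag_op a' e' f' x)" by (simp add: eq px)
  also have "\<dots> \<le> a' n * norm x"
  proof (rule norm_diag_op_le_singular_value[OF A'])
    show "cinner x (e' i) = 0" if "i < n" for i using x(3)[of i] that by simp
  qed
  finally show ?thesis using x(2) by simp
qed

lemma range_diag_op_infinite_dim: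
  assumes A: "singular_system a e f" and inf: "\<not> cfinite_dim (range (diag_op a e f))"
  shows "0 < a n"
proof (rule ccontr)
  assume "\<not> 0 < a n"
  then have zero: "a m = 0" if "m \<ge> n" for m
    using singular_systemD(2)[OF A, of m] singular_systemD(7)[OF A that] by simp
  have "diag_op a e f x = (\<Sum>m<n. (complex_of_real (a m) * cinner x (e m)) *\<^sub>C f m)" for x
    unfolding diag_op_def by (rule suminf_finite) (auto simp: zero)
  moreover have "(\<Sum>m<n. (complex_of_real (a m) * cinner x (e m)) *\<^sub>C f m)
      \<in> complex_vector.span (f ` {..<n})" for x
    by (intro complex_vector.span_sum complex_vector.span_scale complex_vector.span_base) auto
  ultimately have "range (diag_op a e f) \<subseteq> complex_vector.span (f ` {..<n})" by auto
  then have "cfinite_dim (range (diag_op a e f))" unfolding cfinite_dim_def by blast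
  then show False using inf by simp
qed

section \<open>Non-lacunary sequences under index shifts\<close>

text \<open>The ratios are nonnegative, so a liminf different from 0 is positive and bounds them
  below from some \<open>N\<close> on; the finitely many earlier ratios are positive and enter
  through \<open>Min\<close>.\<close>

lemma nonlacunary_ratio:
  assumes pos: "\<And>n. 0 < a n" and "\<not> lacunary a"
  obtains c where "0 < c" "\<And>n. c * a n \<le> a (Suc n)"
proof -
  have "0 \<le> liminf (\<lambda>n. ereal (a (Suc n) / a n))"
    using pos by (intro Liminf_bounded always_eventually) (simp add: less_imp_le)
  then have "0 < liminf (\<lambda>n. ereal (a (Suc n) / a n))"
    using assms(2) unfolding lacunary_def by (simp add: less_le)
  then obtain c where c: "0 < ereal c" "ereal c < liminf (\<lambda>n. ereal (a (Suc n) / a n))"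
    using ereal_dense2 by blast
  then obtain N where N: "\<And>n. n \<ge> N \<Longrightarrow> c < a (Suc n) / a n"
    using less_LiminfD[OF c(2)] unfolding eventually_sequentially by auto
  define d where "d = Min (insert c ((\<lambda>n. a (Suc n) / a n) ` {..<N}))"
  have "d \<le> a (Suc n) / a n" for n
  proof (cases "n < N")
    case True
    then show ?thesis unfolding d_def by (intro Min_le) auto
  next
    case False
    have "d \<le> c" unfolding d_def by (intro Min_le) auto
    then show ?thesis using N[of n] False by simp
  qed
  moreover have "0 < d" unfolding d_def using c(1) pos by (subst Min_gr_iff) auto
  ultimately show ?thesis using that pos by (simp add: field_simps)
qed

lemma nonlacunary_shift:
  assumes pos: "\<And>n. 0 < a n" and "\<not> lacunary a"
  obtains C where "0 < C" "\<And>n. a n \<le> C * a (n + k)"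
proof -
  obtain c where c: "0 < c" "\<And>n. c * a n \<le> a (Suc n)" by (rule nonlacunary_ratio[OF assms]) blast+
  have "c ^ k * a n \<le> a (n + k)" for n
  proof (induction k)
    case (Suc k)
    then have "c * (c ^ k * a n) \<le> c * a (n + k)" using c(1) by (intro mult_left_mono) auto
    also have "\<dots> \<le> a (n + Suc k)" using c(2)[of "n + k"] by simp
    finally show ?case by simp
  qed simp
  then have "a n \<le> (1 / c ^ k) * a (n + k)" for n using c(1) by (simp add: pos_le_divide_eq mult.commute)
  then show ?thesis using that[of "1 / c ^ k"] c(1) by simp
qed


section \<open>Density in the weak operator topology\<close>

text \<open>Induction over the generation of open sets: each open set containing \<open>T\<close>
  eventually contains \<open>X i\<close>. The filter is arbitrary because one density proof uses a
  net over finite sets and the other a sequence.\<close>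

lemma in_wot_closureI:
  assumes T: "bounded_clinear T" and F: "F \<noteq> bot" and U: "eventually (\<lambda>i. X i \<in> U) F"
    and bdd: "\<And>S. S \<in> U \<Longrightarrow> bounded_clinear S"
    and lim: "\<And>x y. ((\<lambda>i. cinner (X i x) y) \<longlongrightarrow> cinner (T x) y) F"
  shows "T \<in> weak_operator_topology closure_of U"
  unfolding in_closure_of topspace_weak_operator_topology
proof (intro conjI allI impI)
  show "T \<in> {T. bounded_clinear T}" using T by simp
  fix W assume W: "T \<in> W \<and> openin weak_operator_topology W"
  then have "generate_topology_on {{T. bounded_clinear T \<and> cinner (T x) y \<in> V} | x y V. open V} W"
    by (simp add: weak_operator_topology_def openin_topology_generated_by_iff)
  then have "T \<in> W \<longrightarrow> eventually (\<lambda>i. X i \<in> W) F"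
  proof induction
    case (UN K)
    show ?case
    proof
      assume "T \<in> \<Union> K"
      then obtain k where "k \<in> K" "T \<in> k" by blast
      then have "eventually (\<lambda>i. X i \<in> k) F" using UN by blast
      then show "\<forall>\<^sub>F i in F. X i \<in> \<Union> K" by (rule eventually_mono) (use \<open>k \<in> K\<close> in blast)
    qed
  next
    case (Basis s)
    then obtain x y V where s: "s = {T. bounded_clinear T \<and> cinner (T x) y \<in> V}" "open V" by blast
    show ?case
    proof
      assume "T \<in> s"
      then have "eventually (\<lambda>i. cinner (X i x) y \<in> V) F"
        using topological_tendstoD[OF lim s(2)] s(1) by simp
      then show "eventually (\<lambda>i. X i \<in> s) F"
        using U by eventually_elim (simp add: s(1) bdd)
    qed
  qed (auto intro: eventually_conj)
  then have "eventually (\<lambda>i. X i \<in> U \<and> X i \<in> W) F" using W U by (simp add: eventually_conj)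
  then show "\<exists>S. S \<in> U \<and> S \<in> W" using eventually_happens F by blast
qed

lemma wot_denseI:
  assumes bdd: "\<And>S. S \<in> U \<Longrightarrow> bounded_clinear S"
    and dense: "\<And>T. bounded_clinear T \<Longrightarrow> T \<in> weak_operator_topology closure_of U"
  shows "wot_dense U"
  unfolding wot_dense_def
  using closure_of_subset_topspace[of weak_operator_topology U] dense
  unfolding topspace_weak_operator_topology by blast

section \<open>Density when the range of the first operator is non-lacunary\<close>

text \<open>With \<open>P\<^sub>u\<close> the projection onto the span of \<open>S\<close> and \<open>P\<^sub>v\<close> the one onto the image of that
  span under the adjoint of \<open>A\<close>, the range of \<open>A (1 - P\<^sub>v)\<close> lies in the kernel of \<open>P\<^sub>u\<close>, so solving
  \<open>W A (1 - P\<^sub>v) Y = B\<close> leaves \<open>X = T P\<^sub>u + W (1 - P\<^sub>u)\<close> free on \<open>S\<close>.  The finitely many lost dimensions only shift the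
  singular values.\<close>

lemma nonlacunary_interpolation:
  fixes A B :: "'a::chilbert_space \<Rightarrow> 'a"
  assumes inf: "\<not> cfinite_dim (UNIV :: 'a set)" and A: "compact_operator A" and B: "compact_operator B"
    and O: "big_O_seq (s_number B) (s_number A)" and nonlac: "nonlacunary_range A"
    and T: "bounded_clinear T" and S: "finite S"
  obtains X where "X \<in> U_XAY A B" "\<And>x. x \<in> S \<Longrightarrow> X x = T x"
proof -
  obtain a e f where A1: "singular_system a e f" and A2: "A = diag_op a e f" and A3: "s_number A = a"
    by (rule compact_operator_singular_system[OF inf A])
  obtain b g h where B1: "singular_system b g h" and B2: "B = diag_op b g h" and B3: "s_number B = b"
    by (rule compact_operator_singular_system[OF inf B])
  have bA: "bounded_clinear A" using A compact_operator_def by blast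
  define As where "As = diag_op a f e"
  have adj: "cinner (A x) y = cinner x (As y)" for x y
    unfolding As_def A2 by (rule cinner_diag_op_swap[OF singular_systemD(4,5,6)[OF A1]])
  obtain m and u :: "nat \<Rightarrow> 'a" where u: "orthonormal_on {..<m} u" "\<And>x. x \<in> S \<Longrightarrow> proj_on {..<m} u x = x"
    by (rule orthonormal_basis_of_finite[OF S]) blast
  obtain k and v :: "nat \<Rightarrow> 'a" where v: "orthonormal_on {..<k} v"
    "\<And>x. x \<in> (\<lambda>i. As (u i)) ` {..<m} \<Longrightarrow> proj_on {..<k} v x = x"
    by (rule orthonormal_basis_of_finite[of "(\<lambda>i. As (u i)) ` {..<m}"]) auto
  define R where "R x = x - proj_on {..<k} v x" for x
  define A' where "A' x = A (R x)" for x
  have bR: "bounded_clinear R"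
    unfolding R_def by (intro bounded_clinear_minus bounded_clinear_id bounded_clinear_proj_on)
  have A': "compact_operator A'" unfolding A'_def by (rule compact_operator_comp[OF A bR])
  obtain a' e' f' where A'1: "singular_system a' e' f'" and A'2: "A' = diag_op a' e' f'"
    by (rule compact_operator_singular_system[OF inf A'])
  have shift: "a (n + k) \<le> a' n" for n
  proof (rule singular_values_of_restriction[OF A1 A'1 v(1)])
    show "diag_op a' e' f' x = diag_op a e f (x - proj_on {..<k} v x)" for x
      using fun_cong[OF A'2, of x] by (simp add: A'_def R_def A2)
  qed
  have pos: "0 < a n" for n
    by (rule range_diag_op_infinite_dim[OF A1]) (use nonlac A2 in \<open>simp add: nonlacunary_range_def\<close>)
  obtain C where C: "0 < C" "\<And>n. a n \<le> C * a (n + k)"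
    by (rule nonlacunary_shift[where a = a and k = k])
      (use pos nonlac A3 in \<open>auto simp: nonlacunary_range_def\<close>)
  obtain D where D: "\<And>n. b n \<le> D * a n" using O unfolding big_O_seq_def A3 B3 by blast
  have "b n \<le> (\<bar>D\<bar> * C) * a' n" for n
  proof -
    have "b n \<le> \<bar>D\<bar> * a n"
      using D[of n] mult_right_mono[OF abs_ge_self[of D] less_imp_le[OF pos[of n]]] by linarith
    also have "\<dots> \<le> \<bar>D\<bar> * (C * a' n)"
      using C(2)[of n] mult_left_mono[OF shift[of n] less_imp_le[OF C(1)]]
      by (intro mult_left_mono) auto
    finally show ?thesis by simp
  qed
  then obtain W Y where W: "bounded_clinear W" and Y: "bounded_clinear Y"
    and WY: "\<And>x. W (A' (Y x)) = B x"
    unfolding A'2 B2 using diag_op_factor[OF A'1 B1] by blast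
  define P where "P = proj_on {..<m} u"
  have bP: "bounded_clinear P" unfolding P_def by (rule bounded_clinear_proj_on)
  have PA': "P (A' x) = 0" for x
    unfolding P_def
  proof (rule proj_on_eq_zero)
    fix i assume i: "i \<in> {..<m}"
    have "cinner (A' x) (u i) = cinner (R x) (proj_on {..<k} v (As (u i)))"
      using v(2)[of "As (u i)"] i by (simp add: A'_def adj)
    also have "\<dots> = 0"
      by (rule cinner_proj_on_eq_zero) (simp add: R_def cinner_diff_proj_on[OF v(1)])
    finally show "cinner (A' x) (u i) = 0" .
  qed
  define X where "X x = T (P x) + W (x - P x)" for x
  show ?thesis
  proof
    show "X x = T x" if "x \<in> S" for x
      using u(2)[OF that] by (simp add: X_def P_def bounded_clinear_zero[OF W])
    have "bounded_clinear X"
      unfolding X_def by (intro bounded_clinear_plus bounded_clinear_comp[OF T bP]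
          bounded_clinear_comp[OF W] bounded_clinear_minus bounded_clinear_id bP)
    moreover have "X \<circ> A \<circ> (\<lambda>x. R (Y x)) = B"
    proof
      fix x
      have "A (R (Y x)) = A' (Y x)" by (simp add: A'_def)
      then show "(X \<circ> A \<circ> (\<lambda>x. R (Y x))) x = B x"
        by (simp add: X_def PA' WY bounded_clinear_zero[OF T])
    qed
    ultimately show "X \<in> U_XAY A B"
      unfolding U_XAY_def using bounded_clinear_comp[OF bR Y]
      by (intro CollectI conjI exI[of _ "\<lambda>x. R (Y x)"])
  qed
qed

text \<open>The interpolating solutions form a net over the finite sets \<open>S\<close>. For fixed
  \<open>x\<close>, \<open>X S x\<close> equals \<open>T x\<close> as soon as \<open>S\<close>
  contains \<open>x\<close>, however large the norms of the \<open>X S\<close> are.\<close>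

lemma wot_dense_nonlacunary:
  fixes A B :: "'a::chilbert_space \<Rightarrow> 'a"
  assumes "\<not> cfinite_dim (UNIV :: 'a set)" "compact_operator A" "compact_operator B"
    and "big_O_seq (s_number B) (s_number A)" "nonlacunary_range A"
  shows "wot_dense (U_XAY A B)"
proof (rule wot_denseI)
  fix T :: "'a \<Rightarrow> 'a" assume T: "bounded_clinear T"
  have "\<exists>X. X \<in> U_XAY A B \<and> (\<forall>x\<in>S. X x = T x)" if "finite S" for S
    by (rule nonlacunary_interpolation[OF assms T that]) blast
  then have "\<forall>S. \<exists>X. finite S \<longrightarrow> X \<in> U_XAY A B \<and> (\<forall>x\<in>S. X x = T x)" by blast
  from choice[OF this] obtain X where X: "\<And>S. finite S \<Longrightarrow> X S \<in> U_XAY A B"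
    "\<And>S x. finite S \<Longrightarrow> x \<in> S \<Longrightarrow> X S x = T x" by blast
  show "T \<in> weak_operator_topology closure_of U_XAY A B"
  proof (rule in_wot_closureI[where X = X and F = "finite_subsets_at_top UNIV"])
    show "\<forall>\<^sub>F S in finite_subsets_at_top UNIV. X S \<in> U_XAY A B"
      by (intro eventually_finite_subsets_at_top_weakI X)
    show "((\<lambda>S. cinner (X S x) y) \<longlongrightarrow> cinner (T x) y) (finite_subsets_at_top UNIV)" for x y
    proof (rule tendsto_eventually)
      show "\<forall>\<^sub>F S in finite_subsets_at_top UNIV. cinner (X S x) y = cinner (T x) y"
        unfolding eventually_finite_subsets_at_top
        by (rule exI[of _ "{x}"]) (auto simp: X(2))
    qed
  qed (auto simp: T U_XAY_def)
qed (simp add: U_XAY_def)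

section \<open>Density when both ranges are dense\<close>

lemma dense_range_orthogonal:
  assumes "dense_range T" "\<And>x. cinner (T x) w = 0" shows "w = 0"
proof -
  have "closed {z. cinner z w = 0}"
  proof (rule closed_Collect_eq)
    show "continuous_on UNIV (\<lambda>z. cinner z w)"
      by (rule linear_continuous_on[OF cinner.bounded_linear_left])
  qed simp
  then have "closure (range T) \<subseteq> {z. cinner z w = 0}"
    using assms(2) by (intro closure_minimal) auto
  then have "cinner w w = 0" using assms(1) unfolding dense_range_def by blast
  then show ?thesis by simp
qed

text \<open>A vector orthogonal to all \<open>f n\<close>, or an \<open>f n\<close> with
  \<open>a n = 0\<close>, is orthogonal to the range. Positivity permits division by
  \<open>a n\<close>; completeness makes the projections onto the first \<open>N\<close> vectors
  converge to the identity.\<close>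

lemma dense_range_singular_system:
  assumes A: "singular_system a e f" and "dense_range (diag_op a e f)"
  shows "0 < a n" and "(\<And>n. cinner z (f n) = 0) \<Longrightarrow> z = 0"
proof -
  note A' = singular_systemD[OF A]
  show "z = 0" if z: "\<And>n. cinner z (f n) = 0" for z
  proof (rule dense_range_orthogonal[OF assms(2)])
    show "cinner (diag_op a e f x) z = 0" for x
      by (simp add: cinner_diag_op_swap[OF A'(4,5,6)] diag_op_eq_zero[OF A'(5,4) z])
  qed
  show "0 < a n"
  proof (rule ccontr)
    assume "\<not> 0 < a n"
    then have "a n = 0" using A'(2)[of n] by simp
    then have "cinner (diag_op a e f x) (f n) = 0" for x
      using cinner_diag_op[where c = a and n = n, OF A'(4,5,6)] by simp
    then have "f n = 0" by (rule dense_range_orthogonal[OF assms(2)])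
    then show False using orthonormal_on_norm[OF A'(5), of n] by simp
  qed
qed

text \<open>Exchanges the blocks \<open>{..<N}\<close> and \<open>{N..<2 * N}\<close>. Since every
  other index stays fixed, the permuted quotients of \<open>b\<close> by \<open>a\<close> remain
  bounded for each \<open>N\<close>.\<close>

definition block_swap :: "nat \<Rightarrow> nat \<Rightarrow> nat" where
  "block_swap N n = (if n < N then n + N else if n < 2 * N then n - N else n)"

lemma block_swap_involution [simp]: "block_swap N (block_swap N n) = n"
  by (auto simp: block_swap_def)

lemma orthonormal_on_block_swap:
  "orthonormal_on UNIV e \<Longrightarrow> orthonormal_on UNIV (\<lambda>n. e (block_swap N n))"
  by (rule orthonormal_on_comp_inj[of "block_swap N" UNIV])
    (auto intro: orthonormal_on_subset inj_on_inverseI[of UNIV "block_swap N"])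

text \<open>The isometry \<open>W\<close> sends \<open>f n\<close> to \<open>h (block_swap N n)\<close>; it satisfies \<open>W A Y1 = B\<close> and
  tends to \<open>0\<close> weakly as \<open>N\<close> grows.  Adding the compression \<open>R\<close> of \<open>T\<close> spoils the equation only by
  the finite-rank term \<open>R A Y1\<close>, which \<open>W A Y2\<close> cancels while \<open>R A Y2 = 0\<close>.\<close>

lemma dense_ranges_solution:
  fixes e f :: "nat \<Rightarrow> 'a::chilbert_space" and g h :: "nat \<Rightarrow> 'a" and T :: "'a \<Rightarrow> 'a"
  assumes A: "singular_system a e f" and B: "singular_system b g h"
    and pos: "\<And>n. 0 < a n" and C: "\<And>n. b n \<le> C * a n" and T: "bounded_clinear T"
  shows "(\<lambda>x. proj_on {..<N} h (T (proj_on {..<N} f x)) + diag_op (\<lambda>_. 1) f (\<lambda>n. h (block_swap N n)) x)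
    \<in> U_XAY (diag_op a e f) (diag_op b g h)"
proof -
  let ?s = "block_swap N"
  note A' = singular_systemD[OF A] and B' = singular_systemD[OF B]
  have gs: "orthonormal_on UNIV (\<lambda>n. g (?s n))" and hs: "orthonormal_on UNIV (\<lambda>n. h (?s n))"
    by (rule orthonormal_on_block_swap, rule B')+
  have fN: "orthonormal_on {..<N} f" and hN: "orthonormal_on {..<N} h"
    using orthonormal_on_subset[OF A'(5)] orthonormal_on_subset[OF B'(5)] by auto
  define W where "W = diag_op (\<lambda>_. 1) f (\<lambda>n. h (?s n))"
  define R where "R x = proj_on {..<N} h (T (proj_on {..<N} f x))" for x
  have one: "\<bar>1 :: real\<bar> \<le> 1" by simp
  have bW: "bounded_clinear W" unfolding W_def by (rule bounded_clinear_diag_op[OF A'(5) hs one])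
  have bR: "bounded_clinear R"
    unfolding R_def by (intro bounded_clinear_comp[OF bounded_clinear_proj_on] bounded_clinear_comp[OF T]
        bounded_clinear_proj_on)
  define q where "q n = b (?s n) / a n" for n
  \<comment> \<open>\<open>C\<close> bounds the quotients at the fixed indices and the sum bounds
    the \<open>2 * N\<close> moved ones. The dependence of \<open>K\<close> on \<open>N\<close>
    affects only the second factor.\<close>
  define K where "K = \<bar>C\<bar> + (\<Sum>n<2 * N. \<bar>q n\<bar>)"
  have q: "\<bar>q n\<bar> \<le> K" for n
  proof (cases "n < 2 * N")
    case True
    then show ?thesis unfolding K_def using member_le_sum[of n "{..<2 * N}" "\<lambda>n. \<bar>q n\<bar>"] by simp
  next
    case False
    then have "q n = b n / a n" by (simp add: q_def block_swap_def)
    then have "0 \<le> q n" "q n \<le> C" using C[of n] pos[of n] B'(2)[of n] by (simp_all add: divide_le_eq)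
    then show ?thesis unfolding K_def by (simp add: add_increasing2 sum_nonneg)
  qed
  define Y1 where "Y1 = diag_op q (\<lambda>n. g (?s n)) e"
  have bY1: "bounded_clinear Y1" unfolding Y1_def by (rule bounded_clinear_diag_op[OF gs A'(4) q])
  have bs: "\<bar>b (?s n)\<bar> \<le> b 0" for n by (rule B')
  have WAY1: "W (diag_op a e f (Y1 x)) = diag_op b g h x" for x
  proof -
    have "(\<lambda>n. a n * q n) = (\<lambda>n. b (?s n))"
      using pos by (auto simp: q_def less_imp_neq[symmetric])
    then have "diag_op a e f (Y1 x) = diag_op (\<lambda>n. b (?s n)) (\<lambda>n. g (?s n)) f x"
      using diag_op_comp[where c = q and d = a, OF gs A'(4) q] by (simp add: Y1_def)
    then have "W (diag_op a e f (Y1 x)) = diag_op (\<lambda>n. b (?s n)) (\<lambda>n. g (?s n)) (\<lambda>n. h (?s n)) x"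
      using diag_op_comp[where c = "\<lambda>n. b (?s n)" and d = "\<lambda>_. 1", OF gs A'(5) bs]
      by (simp add: W_def)
    \<comment> \<open>Coefficients and both families are permuted together, so the operator is
      unchanged; comparison on the vectors \<open>g n\<close> avoids rearranging the series.\<close>
    also have "diag_op (\<lambda>n. b (?s n)) (\<lambda>n. g (?s n)) (\<lambda>n. h (?s n)) = diag_op b g h"
    proof (rule bounded_clinear_eqI_orthonormal[OF bounded_clinear_diag_op[OF gs hs bs] B'(8,4)])
      show "diag_op (\<lambda>n. b (?s n)) (\<lambda>n. g (?s n)) (\<lambda>n. h (?s n)) (g n) = diag_op b g h (g n)" for n
        using diag_op_basis[OF gs hs, of "\<lambda>n. b (?s n)" "?s n"] by (simp add: diag_op_basis[OF B'(4,5)])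
      show "diag_op (\<lambda>n. b (?s n)) (\<lambda>n. g (?s n)) (\<lambda>n. h (?s n)) x = diag_op b g h x"
        if "\<And>n. cinner x (g n) = 0" for x
        by (simp add: diag_op_eq_zero[OF gs hs that] diag_op_eq_zero[OF B'(4,5) that])
    qed
    finally show ?thesis .
  qed
  define Z where "Z x = R (diag_op a e f (Y1 x))" for x
  have bZ: "bounded_clinear Z"
    unfolding Z_def by (intro bounded_clinear_comp[OF bR] bounded_clinear_comp[OF A'(8)] bY1)
  \<comment> \<open>The factor \<open>1 / a (j + N)\<close> cancels the action of \<open>A\<close>,
    and \<open>W\<close> then carries \<open>f (j + N)\<close> to \<open>h j\<close>, which
    reproduces \<open>Z x\<close>. The offset \<open>N\<close> keeps \<open>A Y2\<close> orthogonal
    to \<open>f 0\<close>, ..., \<open>f (N - 1)\<close>, where \<open>R\<close> acts.\<close>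
  define Y2 where "Y2 x = (\<Sum>j<N. (complex_of_real (1 / a (j + N)) * cinner (Z x) (h j)) *\<^sub>C e (j + N))" for x
  have bY2: "bounded_clinear Y2"
    unfolding Y2_def by (intro bounded_clinear_fun_sum bounded_clinear_rank_one bZ)
  have AY2: "diag_op a e f (Y2 x) = (\<Sum>j<N. cinner (Z x) (h j) *\<^sub>C f (j + N))" for x
    unfolding Y2_def bounded_clinear_sum[OF A'(8)] bounded_clinear_scaleC[OF A'(8)] diag_op_basis[OF A'(4,5)]
    by (rule sum.cong) (use pos in \<open>auto simp: scaleC_scaleC less_imp_neq[symmetric]\<close>)
  have "W (diag_op a e f (Y2 x)) = (\<Sum>j<N. cinner (Z x) (h j) *\<^sub>C h j)" for x
    unfolding AY2 bounded_clinear_sum[OF bW] bounded_clinear_scaleC[OF bW]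
    unfolding W_def diag_op_basis[OF A'(5) hs]
    by (rule sum.cong) (auto simp: block_swap_def scaleC_one)
  then have WAY2: "W (diag_op a e f (Y2 x)) = Z x" for x
    using proj_on_idem[OF hN] by (simp add: Z_def R_def proj_on_def)
  have RAY2: "R (diag_op a e f (Y2 x)) = 0" for x
  proof -
    have "proj_on {..<N} f (diag_op a e f (Y2 x)) = 0"
      by (rule proj_on_eq_zero)
        (auto simp: AY2 cinner.sum_left cinner_scaleC_left orthonormal_onD[OF A'(5)] intro!: sum.neutral)
    then show ?thesis
      by (simp add: R_def bounded_clinear_zero[OF T] bounded_clinear_zero[OF bounded_clinear_proj_on])
  qed
  have "(\<lambda>x. R x + W x) \<circ> diag_op a e f \<circ> (\<lambda>x. Y1 x - Y2 x) = diag_op b g h"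
    by (rule ext) (simp add: bounded_clinear_diff[OF A'(8)] bounded_clinear_diff[OF bR]
        bounded_clinear_diff[OF bW] WAY1 WAY2 RAY2 Z_def)
  then have "(\<lambda>x. R x + W x) \<in> U_XAY (diag_op a e f) (diag_op b g h)"
    unfolding U_XAY_def
    using bounded_clinear_plus[OF bR bW] bounded_clinear_minus[OF bY1 bY2]
    by (intro CollectI conjI exI[of _ "\<lambda>x. Y1 x - Y2 x"])
  then show ?thesis by (simp add: R_def W_def)
qed

text \<open>\<open>W N\<close> moves the span of the first \<open>N\<close> vectors
  \<open>f n\<close> away from that of the first \<open>N\<close> vectors \<open>h n\<close>, so
  \<open>W N (P N)\<close> is orthogonal to \<open>Q N\<close>. As \<open>W N\<close> is a
  contraction, the rest is controlled by \<open>x - P N\<close> and \<open>y - Q N\<close>. In the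
  compression of \<open>T\<close> the outer projection is moved onto \<open>y\<close>.\<close>

lemma block_swap_tendsto:
  fixes f h :: "nat \<Rightarrow> 'a::chilbert_space"
  assumes f: "orthonormal_on UNIV f" and h: "orthonormal_on UNIV h" and T: "bounded_clinear T"
    and complete: "\<And>x. (\<And>n. cinner x (f n) = 0) \<Longrightarrow> x = 0" "\<And>x. (\<And>n. cinner x (h n) = 0) \<Longrightarrow> x = 0"
  shows "(\<lambda>N. cinner (proj_on {..<N} h (T (proj_on {..<N} f x))
      + diag_op (\<lambda>_. 1) f (\<lambda>n. h (block_swap N n)) x) y) \<longlonglongrightarrow> cinner (T x) y"
proof -
  define P where "P N = proj_on {..<N} f x" for N
  define Q where "Q N = proj_on {..<N} h y" for N
  define W where "W N = diag_op (\<lambda>_. 1) f (\<lambda>n. h (block_swap N n))" for N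
  have P: "P \<longlonglongrightarrow> x" unfolding P_def by (rule tendsto_proj_on[OF f complete(1)])
  have Q: "Q \<longlonglongrightarrow> y" unfolding Q_def by (rule tendsto_proj_on[OF h complete(2)])
  have hs: "orthonormal_on UNIV (\<lambda>n. h (block_swap N n))" for N by (rule orthonormal_on_block_swap[OF h])
  have one: "\<bar>1 :: real\<bar> \<le> 1" by simp
  have bW: "bounded_clinear (W N)" for N
    unfolding W_def by (rule bounded_clinear_diag_op[OF f hs one])
  have nW: "norm (W N z) \<le> norm z" for N z
    using norm_diag_op_le[OF f hs, where c = "\<lambda>_. 1" and K = 1 and x = z] by (simp add: W_def)
  have orth: "cinner (W N (P N)) (Q N) = 0" for N
    unfolding Q_def
  proof (rule cinner_proj_on_eq_zero)
    fix i assume "i \<in> {..<N}"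
    then have "cinner (W N (P N)) (h i) = cinner (P N) (f (i + N))"
      using cinner_diag_op[where c = "\<lambda>_. 1" and n = "i + N" and x = "P N", OF f hs[of N] one]
      by (simp add: W_def block_swap_def)
    also have "\<dots> = 0" unfolding P_def by (simp add: cinner_proj_on[OF f])
    finally show "cinner (W N (P N)) (h i) = 0" .
  qed
  have "(\<lambda>N. cinner (W N x) y) \<longlonglongrightarrow> 0"
  proof (rule Lim_null_comparison)
    have "norm (cinner (W N x) y) \<le> norm (x - P N) * norm y + norm x * norm (y - Q N)" for N
    proof -
      have "cinner (W N x) y = cinner (W N (x - P N)) y + cinner (W N (P N)) (y - Q N)"
        using orth[of N] by (simp add: bounded_clinear_diff[OF bW] cinner.diff_left cinner.diff_right)
      also have "norm \<dots> \<le> norm (W N (x - P N)) * norm y + norm (W N (P N)) * norm (y - Q N)"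
        by (intro order_trans[OF norm_triangle_ineq] add_mono norm_cinner_le)
      also have "\<dots> \<le> norm (x - P N) * norm y + norm x * norm (y - Q N)"
      proof (intro add_mono mult_right_mono nW norm_ge_zero)
        have "norm (P N) \<le> norm x"
          unfolding P_def by (rule norm_proj_on_le[OF orthonormal_on_subset[OF f]]) auto
        then show "norm (W N (P N)) \<le> norm x" by (rule order_trans[OF nW])
      qed
      finally show ?thesis .
    qed
    then show "\<forall>\<^sub>F N in sequentially.
        norm (cinner (W N x) y) \<le> norm (x - P N) * norm y + norm x * norm (y - Q N)" by simp
    have "(\<lambda>N. norm (x - P N) * norm y + norm x * norm (y - Q N))
        \<longlonglongrightarrow> norm (x - x) * norm y + norm x * norm (y - y)"
      by (intro tendsto_intros P Q)
    then show "(\<lambda>N. norm (x - P N) * norm y + norm x * norm (y - Q N)) \<longlonglongrightarrow> 0" by simp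
  qed
  moreover have "(\<lambda>N. cinner (T (P N)) (Q N)) \<longlonglongrightarrow> cinner (T x) y"
    by (intro cinner.tendsto bounded_clinear_tendsto[OF T] P Q)
  ultimately have "(\<lambda>N. cinner (T (P N)) (Q N) + cinner (W N x) y) \<longlonglongrightarrow> cinner (T x) y + 0"
    by (intro tendsto_add)
  then show ?thesis
    by (simp add: cinner_add_left cinner_proj_on_swap P_def Q_def W_def)
qed

lemma wot_dense_dense_ranges:
  fixes A B :: "'a::chilbert_space \<Rightarrow> 'a"
  assumes inf: "\<not> cfinite_dim (UNIV :: 'a set)" and A: "compact_operator A" and B: "compact_operator B"
    and O: "big_O_seq (s_number B) (s_number A)" and dense: "dense_range A" "dense_range B"
  shows "wot_dense (U_XAY A B)"
proof (rule wot_denseI)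
  fix T :: "'a \<Rightarrow> 'a" assume T: "bounded_clinear T"
  obtain a e f where A1: "singular_system a e f" and A2: "A = diag_op a e f" and A3: "s_number A = a"
    by (rule compact_operator_singular_system[OF inf A])
  obtain b g h where B1: "singular_system b g h" and B2: "B = diag_op b g h" and B3: "s_number B = b"
    by (rule compact_operator_singular_system[OF inf B])
  obtain C where C: "\<And>n. b n \<le> C * a n" using O unfolding big_O_seq_def A3 B3 by blast
  note dA = dense(1)[unfolded A2] and dB = dense(2)[unfolded B2]
  show "T \<in> weak_operator_topology closure_of U_XAY A B"
  proof (rule in_wot_closureI[OF T sequentially_bot])
    show "\<forall>\<^sub>F N in sequentially. (\<lambda>x. proj_on {..<N} h (T (proj_on {..<N} f x))
        + diag_op (\<lambda>_. 1) f (\<lambda>n. h (block_swap N n)) x) \<in> U_XAY A B"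
      unfolding A2 B2
      by (intro always_eventually allI dense_ranges_solution[OF A1 B1 dense_range_singular_system(1)[OF A1 dA] C T])
    show "(\<lambda>N. cinner (proj_on {..<N} h (T (proj_on {..<N} f x))
        + diag_op (\<lambda>_. 1) f (\<lambda>n. h (block_swap N n)) x) y) \<longlonglongrightarrow> cinner (T x) y" for x y
      by (rule block_swap_tendsto[OF singular_systemD(5)[OF A1] singular_systemD(5)[OF B1] T
            dense_range_singular_system(2)[OF A1 dA] dense_range_singular_system(2)[OF B1 dB]])
  qed (simp add: U_XAY_def)
qed (simp add: U_XAY_def)

section \<open>The obstruction to density\<close>

text \<open>\<open>c\<close> selects the \<open>h n\<close> with \<open>b n\<close> nonzero, so
  \<open>p\<close> is the orthogonal projection of \<open>v\<close> onto the closure of the range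
  and \<open>v - p\<close> is the required vector.\<close>

lemma orthogonal_to_range:
  assumes B: "singular_system b g h" and "\<not> dense_range (diag_op b g h)"
  obtains w where "w \<noteq> 0" "\<And>x. cinner (diag_op b g h x) w = 0"
proof -
  note B' = singular_systemD[OF B]
  let ?B = "diag_op b g h"
  obtain v where v: "v \<notin> closure (range ?B)" using assms(2) unfolding dense_range_def by blast
  define c where "c n = (if b n = 0 then 0 else 1 :: real)" for n
  have c: "\<bar>c n\<bar> \<le> 1" for n by (simp add: c_def)
  define p where "p = diag_op c h h v"
  \<comment> \<open>The partial sums have explicit preimages with coefficients
    \<open>1 / b n\<close>; for \<open>b n = 0\<close> both \<open>c n\<close> and, by convention,
    \<open>1 / b n\<close> are 0.\<close>
  have range: "(\<Sum>n<N. (complex_of_real (c n) * cinner v (h n)) *\<^sub>C h n) \<in> range ?B" for N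
  proof (rule range_eqI)
    show "(\<Sum>n<N. (complex_of_real (c n) * cinner v (h n)) *\<^sub>C h n)
      = ?B (\<Sum>n<N. (complex_of_real (1 / b n) * cinner v (h n)) *\<^sub>C g n)"
      unfolding bounded_clinear_sum[OF B'(8)] bounded_clinear_scaleC[OF B'(8)] diag_op_basis[OF B'(4,5)]
      by (rule sum.cong) (auto simp: c_def scaleC_scaleC)
  qed
  have "p \<in> closure (range ?B)"
    unfolding closure_sequential
  proof (intro exI conjI allI)
    show "(\<lambda>N. \<Sum>n<N. (complex_of_real (c n) * cinner v (h n)) *\<^sub>C h n) \<longlonglongrightarrow> p"
      using diag_op_sums[where c = c and x = v, OF B'(5,5) c] by (simp add: sums_def p_def)
  qed (rule range)
  then have "v - p \<noteq> 0" using v by auto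
  moreover have "cinner (?B x) (v - p) = 0" for x
  proof -
    have bs: "bounded_clinear (diag_op b h g)" by (rule bounded_clinear_diag_op[OF B'(5,4,6)])
    have "(\<lambda>n. b n * c n) = b" by (auto simp: c_def)
    then have "diag_op b h g p = diag_op b h g v"
      using diag_op_comp[where c = c and d = b, OF B'(5,5) c] by (simp add: p_def)
    then have "diag_op b h g (v - p) = 0" by (simp add: bounded_clinear_diff[OF bs])
    then show ?thesis by (simp add: cinner_diag_op_swap[OF B'(4,5,6)])
  qed
  ultimately show ?thesis using that by blast
qed

text \<open>The condition \<open>\<langle>X A Y x, w\<rangle> = 0\<close> expresses the component of \<open>A Y x\<close> along \<open>f 0\<close> through the
  remaining ones, so one singular value of \<open>A\<close> is lost.\<close>

lemma singular_values_of_constrained_product: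
  assumes A: "singular_system a e f" and B: "singular_system b g h"
    and X: "bounded_clinear X" and Y: "bounded_clinear Y"
    and eq: "\<And>x. X (diag_op a e f (Y x)) = diag_op b g h x"
    and w: "\<And>x. cinner (diag_op b g h x) w = 0" "cinner (X (f 0)) w \<noteq> 0"
  shows "\<exists>C. \<forall>n. b n \<le> C * a (Suc n)"
proof -
  note A' = singular_systemD[OF A]
  let ?A = "diag_op a e f"
  define r where "r = cmod (cinner (X (f 0)) w)"
  have r: "r > 0" using w(2) by (simp add: r_def)
  obtain K where K: "0 < K" "\<And>x. norm (X x) \<le> K * norm x" using bounded_clinear_bound[OF X] by blast
  obtain L where L: "0 < L" "\<And>x. norm (Y x) \<le> L * norm x" using bounded_clinear_bound[OF Y] by blast
  \<comment> \<open>The bound for \<open>t\<close> derived below is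
    \<open>K * norm (?A z) * norm w / r\<close>. Hence the first summand of \<open>M\<close>
    accounts for \<open>t *\<^sub>C X (f 0)\<close> and the second for
    \<open>X (?A z)\<close>.\<close>
  define M where "M = K * norm w / r * norm (X (f 0)) + K"
  have M: "0 \<le> M" using K(1) r by (simp add: M_def)
  have "b n \<le> (M * 2 * L) * a (Suc n)" for n
  proof -
    \<comment> \<open>Only \<open>n\<close> conditions are imposed, against \<open>e 1\<close>, ...,
      \<open>e n\<close>. The component along \<open>e 0\<close> is subtracted by hand in
      \<open>z\<close>, which is thus orthogonal to \<open>n + 1\<close> vectors and gives
      \<open>a (Suc n)\<close>; the factor 2 comes from the triangle inequality for
      \<open>z\<close>.\<close>
    obtain x where x: "x \<in> complex_vector.span (g ` {..n})" "x \<noteq> 0"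
      "\<And>i. i < n \<Longrightarrow> cinner (Y x) (e (Suc i)) = 0"
      using exists_orthogonal_in_span[OF orthonormal_on_subset[OF singular_systemD(4)[OF B] subset_UNIV] Y,
          of n "\<lambda>i. e (Suc i)"] by blast
    define z where "z = Y x - cinner (Y x) (e 0) *\<^sub>C e 0"
    define t where "t = cinner (Y x) (e 0) * complex_of_real (a 0)"
    have "cinner z (e i) = 0" if "i < Suc n" for i
      using that x(3) by (cases i)
        (auto simp: z_def cinner.diff_left cinner_scaleC_left orthonormal_onD[OF A'(4)])
    then have "norm (?A z) \<le> a (Suc n) * norm z" by (rule norm_diag_op_le_singular_value[OF A])
    also have "norm z \<le> 2 * norm (Y x)"
    proof -
      have "norm z \<le> norm (Y x) + norm (cinner (Y x) (e 0) *\<^sub>C e 0)"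
        unfolding z_def by (rule norm_triangle_ineq4)
      also have "norm (cinner (Y x) (e 0) *\<^sub>C e 0) \<le> norm (Y x)"
        using norm_cinner_le[of "Y x" "e 0"] orthonormal_on_norm[OF A'(4)] by simp
      finally show ?thesis by simp
    qed
    also have "\<dots> \<le> 2 * (L * norm x)" using L(2)[of x] by simp
    finally have nAz: "norm (?A z) \<le> a (Suc n) * (2 * (L * norm x))"
      using A'(2)[of "Suc n"] by (simp add: mult_left_mono)
    have nXAz: "norm (X (?A z)) \<le> K * norm (?A z)" by (rule K(2))
    have "Y x = cinner (Y x) (e 0) *\<^sub>C e 0 + z" by (simp add: z_def)
    then have "?A (Y x) = t *\<^sub>C f 0 + ?A z"
      using bounded_clinear_add[OF A'(8), of "cinner (Y x) (e 0) *\<^sub>C e 0" z]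
      by (simp add: t_def bounded_clinear_scaleC[OF A'(8)] diag_op_basis[OF A'(4,5)] scaleC_scaleC)
    then have Bx: "diag_op b g h x = t *\<^sub>C X (f 0) + X (?A z)"
      using eq[of x] by (simp add: bounded_clinear_add[OF X] bounded_clinear_scaleC[OF X])
    have "t * cinner (X (f 0)) w + cinner (X (?A z)) w = 0"
      using w(1)[of x] unfolding Bx by (simp add: cinner_add_left cinner_scaleC_left)
    then have "cmod (t * cinner (X (f 0)) w) = cmod (cinner (X (?A z)) w)"
      by (simp add: add_eq_0_iff2)
    also have "\<dots> \<le> K * norm (?A z) * norm w"
      by (rule order_trans[OF norm_cinner_le]) (simp add: mult_right_mono nXAz)
    finally have "cmod t \<le> K * norm (?A z) * norm w / r"
      using r by (simp add: norm_mult r_def[symmetric] pos_le_divide_eq)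
    then have "cmod t * norm (X (f 0)) \<le> K * norm (?A z) * norm w / r * norm (X (f 0))"
      by (rule mult_right_mono) simp
    then have "norm (diag_op b g h x) \<le> M * norm (?A z)"
      using norm_triangle_ineq[of "t *\<^sub>C X (f 0)" "X (?A z)"] nXAz
      unfolding Bx by (simp add: M_def algebra_simps)
    also have "\<dots> \<le> M * (a (Suc n) * (2 * (L * norm x)))" by (rule mult_left_mono[OF nAz M])
    finally have "b n * norm x \<le> M * (a (Suc n) * (2 * (L * norm x)))"
      using singular_value_le_on_span[OF B x(1)] by linarith
    then show ?thesis using x(2) by (simp add: mult_ac)
  qed
  then show ?thesis by blast
qed

lemma not_wot_dense:
  fixes A B :: "'a::chilbert_space \<Rightarrow> 'a"
  assumes inf: "\<not> cfinite_dim (UNIV :: 'a set)" and A: "compact_operator A" and B: "compact_operator B"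
    and not_dense: "\<not> dense_range B" and not_O: "\<not> big_O_seq (s_number B) (\<lambda>n. s_number A (Suc n))"
  shows "\<not> wot_dense (U_XAY A B)"
proof
  assume wot: "wot_dense (U_XAY A B)"
  obtain a e f where A1: "singular_system a e f" and A2: "A = diag_op a e f" and A3: "s_number A = a"
    by (rule compact_operator_singular_system[OF inf A])
  obtain b g h where B1: "singular_system b g h" and B2: "B = diag_op b g h" and B3: "s_number B = b"
    by (rule compact_operator_singular_system[OF inf B])
  obtain w where w: "w \<noteq> 0" "\<And>x. cinner (diag_op b g h x) w = 0"
    using orthogonal_to_range[OF B1 not_dense[unfolded B2]] by blast
  \<comment> \<open>This operator shows that the open set \<open>G\<close> is nonempty: it maps
    \<open>f 0\<close> to \<open>w\<close>, and \<open>cinner w w\<close> is nonzero.\<close>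
  define T where "T x = cinner x (f 0) *\<^sub>C w" for x
  have "bounded_clinear T" unfolding T_def using bounded_clinear_rank_one[OF bounded_clinear_id, of 1] by simp
  then have "T \<in> weak_operator_topology closure_of U_XAY A B" using wot by (simp add: wot_dense_def)
  moreover define G where "G = {X. bounded_clinear X \<and> cinner (X (f 0)) w \<in> - {0}}"
  have "openin weak_operator_topology G"
    unfolding weak_operator_topology_def G_def
    by (rule topology_generated_by_Basis) (use open_Compl[OF closed_singleton] in blast)
  moreover have "T \<in> G"
    using \<open>bounded_clinear T\<close> w(1) orthonormal_onD[OF singular_systemD(5)[OF A1], of 0 0]
    by (simp add: G_def T_def scaleC_one)
  ultimately obtain X where "X \<in> U_XAY A B" "X \<in> G" unfolding in_closure_of by blast
  then obtain Y where X: "bounded_clinear X" "cinner (X (f 0)) w \<noteq> 0" and Y: "bounded_clinear Y"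
    and eq: "X \<circ> A \<circ> Y = B" by (auto simp: U_XAY_def G_def)
  have "X (diag_op a e f (Y x)) = diag_op b g h x" for x
    using fun_cong[OF eq, of x] unfolding A2 B2 by simp
  from singular_values_of_constrained_product[OF A1 B1 X(1) Y this w(2) X(2)]
  show False using not_O by (simp add: big_O_seq_def A3 B3)
qed

section \<open>Solvability and the combined statement\<close>

lemma solvable_XAY_iff:
  fixes A B :: "'a::chilbert_space \<Rightarrow> 'a"
  assumes inf: "\<not> cfinite_dim (UNIV :: 'a set)" and A: "compact_operator A" and B: "compact_operator B"
  shows "solvable_XAY A B \<longleftrightarrow> big_O_seq (s_number B) (s_number A)"
proof -
  obtain a e f where A1: "singular_system a e f" and A2: "A = diag_op a e f" and A3: "s_number A = a"
    by (rule compact_operator_singular_system[OF inf A])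
  obtain b g h where B1: "singular_system b g h" and B2: "B = diag_op b g h" and B3: "s_number B = b"
    by (rule compact_operator_singular_system[OF inf B])
  show ?thesis
  proof
    assume "solvable_XAY A B"
    then obtain X Y where XY: "bounded_clinear X" "bounded_clinear Y" and eq: "X \<circ> A \<circ> Y = B"
      by (auto simp: solvable_XAY_def)
    have "X (diag_op a e f (Y x)) = diag_op b g h x" for x
      using fun_cong[OF eq, of x] unfolding A2 B2 by simp
    from singular_values_of_product[OF A1 B1 XY this]
    show "big_O_seq (s_number B) (s_number A)" by (simp add: big_O_seq_def A3 B3)
  next
    assume "big_O_seq (s_number B) (s_number A)"
    then obtain C where "\<And>n. b n \<le> C * a n" unfolding big_O_seq_def A3 B3 by blast
    from diag_op_factor[OF A1 B1 this] obtain X Y where XY: "bounded_clinear X" "bounded_clinear Y"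
      and eq: "\<And>x. X (diag_op a e f (Y x)) = diag_op b g h x" by blast
    have "X \<circ> A \<circ> Y = B" unfolding A2 B2 using eq by (intro ext) simp
    then show "solvable_XAY A B" using XY by (auto simp: solvable_XAY_def)
  qed
qed

theorem corollary8p1:
  fixes A B :: "'h::chilbert_space \<Rightarrow> 'h"
  assumes "separable_space (euclidean :: 'h topology)"
    and "\<not> cfinite_dim (UNIV :: 'h set)"
    and "compact_operator A" and "compact_operator B"
  shows "(solvable_XAY A B \<longleftrightarrow> big_O_seq (s_number B) (s_number A))
    \<and> (big_O_seq (s_number B) (s_number A) \<longrightarrow>
         (dense_range A \<and> dense_range B) \<or> nonlacunary_range A \<longrightarrow>
         wot_dense (U_XAY A B))
    \<and> (\<not> dense_range B \<and> \<not> big_O_seq (s_number B) (\<lambda>n. s_number A (Suc n)) \<longrightarrow>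
         \<not> wot_dense (U_XAY A B))"
  using solvable_XAY_iff[OF assms(2-4)] wot_dense_dense_ranges[OF assms(2-4)]
    wot_dense_nonlacunary[OF assms(2-4)] not_wot_dense[OF assms(2-4)]
  by blast

end
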